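(* Let $(Y_t)_{t\in\mathbb Z}$ and $(X_t)_{t\in\mathbb Z}$ be stationary real-valued time series with $Y_t=\Phi(Y_{t-1},\epsilon_t)$ and $X_t=\Psi(Y_t,\epsilon_{t+1},\dots,\epsilon_{t+s})$, $t\in\mathbb Z$, in the setting described in the context. Let $(|X_0|,Y_0,\dots,Y_s)\in[0,\infty)\times\mathbb R^{s+1}$ be a multivariate regularly varying vector with index $\alpha$ and let Condition 1 (see context) hold. Then there exists a random vector $(Y_0^{(X)},\dots,Y_s^{(X)})$ such that, in the sense of weak convergence, $$\lim_{x\to\infty}\mathcal L\left(\frac{Y_0}{x},\dots,\frac{Y_s}{x}\;\middle|\;|X_0|>x\right)=\mathcal L(Y_0^{(X)},\dots,Y_s^{(X)}).$$
   Context: Setting: $s\ge 1$ is an integer, $(\mathbb S,\mathcal S)$ is a measurable space, $(\epsilon_t)_{t\in\mathbb Z}$ is an i.i.d. sequence of $\mathbb S$-valued random variables, $\Phi:\mathbb R\times\mathbb S\to\mathbb R$ and $\Psi:\mathbb R\times\mathbb S^{s}\to\mathbb R$ are measurable, and for every $r\in\mathbb Z$ the innovations $(\epsilon_t)_{t>r}$ are independent of $(Y_t)_{t\le r}$. Condition 1: there are $\alpha>0$, $p,p'\in[0,1]$ and $C\in(0,\infty)$ with (1.a) $\lim_{x\to\infty}P(|Y_0|>ux)/P(|Y_0|>x)=u^{-\alpha}$ for all $u>0$ and $\lim_{x\to\infty}P(Y_0>x)/P(|Y_0|>x)=p$; (1.b) $\lim_{x\to\infty}P(|X_0|>ux)/P(|X_0|>x)=u^{-\alpha}$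 for all $u>0$ and $\lim_{x\to\infty}P(X_0>x)/P(|X_0|>x)=p'$; and $\lim_{x\to\infty}P(|X_0|>x)/P(|Y_0|>x)=C$. Multivariate regular variation: a measurable $U:\mathbb R_+\to\mathbb R_+$ is regularly varying with index $\rho\in\mathbb R$ if $\lim_{x\to\infty}U(\tau x)/U(x)=\tau^{\rho}$ for all $\tau>0$. The vector $\mathbf Z=(|X_0|,Y_0,\dots,Y_s)$ is multivariate regularly varying with index $\alpha$ if there are a regularly varying function $U:\mathbb R_+\to\mathbb R_+$ with index $-\alpha$ and a non-degenerate, non-zero Radon measure $\nu$ on $\mathbb C=([0,\infty]\times[-\infty,\infty]^{s+1})\setminus\{\mathbf 0\}$ such that $P(\mathbf Z\in x\,\cdot\,)/U(x)$ converges vaguely to $\nu(\cdot)$ on $\mathbb C$ as $x\to\infty$. *)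

theory Defs
  imports "HOL-Probability.Probability"
begin

section \<open>Time series and independence\<close>

text \<open>Strict stationarity: the law of the whole path is shift invariant.\<close>

definition stationary :: "'a measure \<Rightarrow> (int \<Rightarrow> 'a \<Rightarrow> real) \<Rightarrow> bool" where
  "stationary M X \<longleftrightarrow>
     (\<forall>t. X t \<in> borel_measurable M) \<and>
     (\<forall>h. distr M (\<Pi>\<^sub>M t\<in>UNIV. borel) (\<lambda>\<omega> t. X (t + h) \<omega>)
        = distr M (\<Pi>\<^sub>M t\<in>UNIV. borel) (\<lambda>\<omega> t. X t \<omega>))"

definition iid :: "'a measure \<Rightarrow> 'b measure \<Rightarrow> (int \<Rightarrow> 'a \<Rightarrow> 'b) \<Rightarrow> bool" where
  "iid M S eps \<longleftrightarrow>
     prob_space.indep_vars M (\<lambda>_. S) eps UNIV \<and>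
     (\<forall>t. distr M S (eps t) = distr M S (eps 0))"

text \<open>Independence of two random elements whose value types may differ
  (\<open>indep_var\<close> requires a common one).\<close>

definition indep_elements ::
  "'a measure \<Rightarrow> 'b measure \<Rightarrow> ('a \<Rightarrow> 'b) \<Rightarrow> 'c measure \<Rightarrow> ('a \<Rightarrow> 'c) \<Rightarrow> bool" where
  "indep_elements M N V K W \<longleftrightarrow>
     V \<in> measurable M N \<and> W \<in> measurable M K \<and>
     prob_space.indep_set M {V -` A \<inter> space M | A. A \<in> sets N} {W -` B \<inter> space M | B. B \<in> sets K}"


section \<open>Univariate regular variation\<close>

definition regularly_varying :: "(real \<Rightarrow> real) \<Rightarrow> real \<Rightarrow> bool" where
  "regularly_varying U \<rho> \<longleftrightarrow>
     U \<in> borel_measurable (restrict_space borel {0..}) \<and> (\<forall>x\<ge>0. U x \<ge> 0) \<and>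
     (\<forall>\<tau>>0. ((\<lambda>x. U (\<tau> * x) / U x) \<longlongrightarrow> \<tau> powr \<rho>) at_top)"

definition balanced_tails :: "'a measure \<Rightarrow> ('a \<Rightarrow> real) \<Rightarrow> real \<Rightarrow> real \<Rightarrow> bool" where
  "balanced_tails M V \<alpha> p \<longleftrightarrow>
     (\<forall>u>0. ((\<lambda>x. \<P>(\<omega> in M. \<bar>V \<omega>\<bar> > u * x) / \<P>(\<omega> in M. \<bar>V \<omega>\<bar> > x)) \<longlongrightarrow> u powr (- \<alpha>)) at_top) \<and>
     ((\<lambda>x. \<P>(\<omega> in M. V \<omega> > x) / \<P>(\<omega> in M. \<bar>V \<omega>\<bar> > x)) \<longlongrightarrow> p) at_top"

definition condition_1 :: "'a measure \<Rightarrow> ('a \<Rightarrow> real) \<Rightarrow> ('a \<Rightarrow> real) \<Rightarrow> real \<Rightarrow> bool" where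
  "condition_1 M X0 Y0 \<alpha> \<longleftrightarrow> \<alpha> > 0 \<and>
     (\<exists>p\<in>{0..1}. \<exists>p'\<in>{0..1}. \<exists>C>0.
        balanced_tails M Y0 \<alpha> p \<and> balanced_tails M X0 \<alpha> p' \<and>
        ((\<lambda>x. \<P>(\<omega> in M. \<bar>X0 \<omega>\<bar> > x) / \<P>(\<omega> in M. \<bar>Y0 \<omega>\<bar> > x)) \<longlongrightarrow> C) at_top)"


section \<open>Vague and weak convergence\<close>

definition vague_convergence ::
  "'z topology \<Rightarrow> ('i \<Rightarrow> 'z measure) \<Rightarrow> 'z measure \<Rightarrow> 'i filter \<Rightarrow> bool" where
  "vague_convergence T \<mu> \<nu> F \<longleftrightarrow>
     (\<forall>f. continuous_map T euclideanreal f \<and>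
          (\<exists>K. compactin T K \<and> (\<forall>z\<in>topspace T - K. f z = 0)) \<longrightarrow>
        ((\<lambda>i. \<integral>z. f z \<partial>\<mu> i) \<longlongrightarrow> (\<integral>z. f z \<partial>\<nu>)) F)"

definition weak_convergence ::
  "'z topology \<Rightarrow> ('i \<Rightarrow> 'z measure) \<Rightarrow> 'z measure \<Rightarrow> 'i filter \<Rightarrow> bool" where
  "weak_convergence T \<mu> \<nu> F \<longleftrightarrow>
     (\<forall>f. continuous_map T euclideanreal f \<and> bounded (f ` topspace T) \<longrightarrow>
        ((\<lambda>i. \<integral>z. f z \<partial>\<mu> i) \<longlongrightarrow> (\<integral>z. f z \<partial>\<nu>)) F)"


section \<open>Multivariate regular variation\<close>

text \<open>Vectors indexed by \<open>0, \<dots>, s\<close> are the extensional functions in \<open>\<Pi>\<^sub>E i\<in>{0..s}. UNIV\<close>, so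
  that the dimension may depend on the natural number \<open>s\<close>. The set \<open>cone s\<close> is
  \<open>([0,\<infinity>] \<times> [-\<infinity>,\<infinity>]\<^sup>s\<^sup>+\<^sup>1) - {0}\<close>; as the origin is removed and infinity is not, its compact
  subsets are the closed sets bounded away from the origin.\<close>

definition cone :: "nat \<Rightarrow> (ereal \<times> (nat \<Rightarrow> ereal)) set" where
  "cone s = ({0..} \<times> (\<Pi>\<^sub>E i\<in>{0..s}. UNIV)) - {(0, \<lambda>i\<in>{0..s}. 0)}"

definition cone_topology :: "nat \<Rightarrow> (ereal \<times> (nat \<Rightarrow> ereal)) topology" where
  "cone_topology s =
     subtopology (prod_topology euclidean (product_topology (\<lambda>_. euclidean) {0..s})) (cone s)"

definition ext_borel :: "nat \<Rightarrow> (ereal \<times> (nat \<Rightarrow> ereal)) measure" where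
  "ext_borel s = borel \<Otimes>\<^sub>M (\<Pi>\<^sub>M i\<in>{0..s}. borel)"

text \<open>All factors are second countable, so the sets of \<open>restrict_space (ext_borel s) (cone s)\<close> are
  the Borel sets of \<open>cone_topology s\<close>. That space is moreover locally compact, so finiteness on
  compact sets makes a measure Radon. Non-degenerate means not concentrated at a single point.\<close>

definition nondegenerate_radon :: "nat \<Rightarrow> (ereal \<times> (nat \<Rightarrow> ereal)) measure \<Rightarrow> bool" where
  "nondegenerate_radon s \<nu> \<longleftrightarrow>
     sets \<nu> = sets (restrict_space (ext_borel s) (cone s)) \<and>
     (\<forall>K. compactin (cone_topology s) K \<longrightarrow> emeasure \<nu> K < \<infinity>) \<and>
     emeasure \<nu> (cone s) \<noteq> 0 \<and>
     (\<forall>z\<in>cone s. emeasure \<nu> (cone s - {z}) \<noteq> 0)"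

text \<open>\<open>scaled_law M s V W x\<close> is \<open>B \<mapsto> P((V, W\<^sub>0, \<dots>, W\<^sub>s) \<in> x B)\<close> on \<open>cone s\<close>.\<close>

definition scaled_law ::
  "'a measure \<Rightarrow> nat \<Rightarrow> ('a \<Rightarrow> real) \<Rightarrow> (nat \<Rightarrow> 'a \<Rightarrow> real) \<Rightarrow> real \<Rightarrow>
   (ereal \<times> (nat \<Rightarrow> ereal)) measure" where
  "scaled_law M s V W x =
     restrict_space
       (distr M (ext_borel s) (\<lambda>\<omega>. (ereal (V \<omega> / x), \<lambda>i\<in>{0..s}. ereal (W i \<omega> / x))))
       (cone s)"

definition multivariate_regularly_varying ::
  "'a measure \<Rightarrow> nat \<Rightarrow> ('a \<Rightarrow> real) \<Rightarrow> (nat \<Rightarrow> 'a \<Rightarrow> real) \<Rightarrow> real \<Rightarrow> bool" where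
  "multivariate_regularly_varying M s V W \<alpha> \<longleftrightarrow>
     (\<exists>U \<nu>. regularly_varying U (- \<alpha>) \<and> nondegenerate_radon s \<nu> \<and>
        vague_convergence (cone_topology s)
          (\<lambda>x. scale_measure (ennreal (1 / U x)) (scaled_law M s V W x)) \<nu> at_top)"


section \<open>Laws on real vectors\<close>

definition vec_borel :: "nat \<Rightarrow> (nat \<Rightarrow> real) measure" where
  "vec_borel s = (\<Pi>\<^sub>M i\<in>{0..s}. borel)"

definition vec_topology :: "nat \<Rightarrow> (nat \<Rightarrow> real) topology" where
  "vec_topology s = product_topology (\<lambda>_. euclidean) {0..s}"

definition law :: "'a measure \<Rightarrow> nat \<Rightarrow> (nat \<Rightarrow> 'a \<Rightarrow> real) \<Rightarrow> (nat \<Rightarrow> real) measure" where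
  "law M s V = distr M (vec_borel s) (\<lambda>\<omega>. \<lambda>i\<in>{0..s}. V i \<omega>)"

text \<open>\<open>uniform_measure M A\<close> is \<open>P(\<cdot> | A)\<close>.\<close>

definition cond_law ::
  "'a measure \<Rightarrow> nat \<Rightarrow> (nat \<Rightarrow> 'a \<Rightarrow> real) \<Rightarrow> ('a \<Rightarrow> bool) \<Rightarrow> (nat \<Rightarrow> real) measure" where
  "cond_law M s V Q = law (uniform_measure M {\<omega> \<in> space M. Q \<omega>}) s V"

end

(* After dividing by U, the law of (|X_0|, Y_0, ..., Y_s) / x on the event |X_0| > x is close to the
   restriction of the limit measure nu to {z_0 > 1}. Regular variation of the tail of |X_0| makes
   P(|X_0| > x) / U(x) converge to c = nu {z_0 > 1}. Since every |Y_i| has a tail comparable to that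
   of |X_0|, c = 0 would force nu = 0; so c > 0. The same comparison bounds nu {|z_i| > R} by a
   multiple of R^(-alpha), so nu does not charge infinity. Hence vague convergence, applied to a
   bounded continuous function of the Y-coordinates clamped to [-n, n] times a ramp approximating
   the indicator of z_0 > 1, yields weak convergence to nu( . | z_0 > 1) as n grows. *)

theory Submission
  imports Defs
begin

section \<open>Cut-off functions on the extended reals\<close>

text \<open>Two features of the limit shape the argument. First, the indicator of z_0 > 1 jumps on
  {z_0 = 1}, a set not known in advance to be \<open>\<nu>\<close>-null. Rather than proving
  nullity, the error is measured before the limit: a ramp from 1 to b differs from the indicator
  only for x < |X_0| \<le> b x, and the probability of that event divided by U(x) tends to (1 -
  b^(-\<alpha>)) c, which vanishes as b decreases to 1. Second, the cone contains points with
  infinite coordinates, to which a bounded continuous function of real vectors need not extend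
  continuously; this forces the clamping. Its cost is a multiple of the sum of P(|Y_i| > n x) /
  U(x), whose terms tend to D n^(-\<alpha>) c. Here D = 1/C for every i, because stationarity gives
  all Y_i the tail of Y_0. Both errors are explicit in x for fixed n, so the limits in x and in n
  can be taken one after the other without any uniformity.\<close>

lemma tendsto_approx:
  fixes J :: "'i \<Rightarrow> real"
  assumes I: "\<And>n::nat. (I n \<longlongrightarrow> L n) F" and L: "L \<longlonglongrightarrow> l"
    and le: "\<And>n. eventually (\<lambda>x. \<bar>J x - I n x\<bar> \<le> E n x) F"
    and E: "\<And>n. (E n \<longlongrightarrow> e n) F" and e: "e \<longlonglongrightarrow> 0"
  shows "(J \<longlongrightarrow> l) F"
proof (rule tendstoI)
  fix d :: real assume d: "d > 0"
  \<comment> \<open>One n is fixed through the limits of \<open>L\<close> and \<open>e\<close>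
    before x moves, so \<open>le\<close>, \<open>I\<close> and \<open>E\<close> enter for this
    single n only.\<close>
  have "\<forall>\<^sub>F n in sequentially. dist (L n) l < d / 3 \<and> e n < d / 3"
    using tendstoD[OF L, of "d/3"] order_tendstoD(2)[OF e, of "d/3"] d
    by (auto intro: eventually_conj)
  then obtain n where n: "dist (L n) l < d / 3" "e n < d / 3"
    by (auto simp: eventually_sequentially)
  show "\<forall>\<^sub>F x in F. dist (J x) l < d"
    using le[of n] order_tendstoD(2)[OF E[of n] n(2)] tendstoD[OF I[of n], of "d/3", simplified, OF d]
  proof eventually_elim
    case (elim x)
    have "\<bar>J x - l\<bar> \<le> \<bar>J x - I n x\<bar> + \<bar>I n x - L n\<bar> + \<bar>L n - l\<bar>" by linarith
    with elim n(1) show ?case by (simp add: dist_real_def)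
  qed
qed

text \<open>Clamping takes place in \<open>ereal\<close>, before the conversion, so
  \<open>real_of_ereal\<close> never meets an infinite value. This is what makes the map continuous
  at both infinities.\<close>

definition clamp_ereal :: "real \<Rightarrow> real \<Rightarrow> ereal \<Rightarrow> real" where
  "clamp_ereal a b t = real_of_ereal (max (ereal a) (min (ereal b) t))"

lemma clamp_ereal_ereal: "a \<le> b \<Longrightarrow> clamp_ereal a b (ereal t) = max a (min b t)"
  by (simp add: clamp_ereal_def max_def min_def)

lemma clamp_ereal_bounds:
  assumes "a \<le> b"
  shows "a \<le> clamp_ereal a b t" "clamp_ereal a b t \<le> b"
  using assms by (cases t; simp add: clamp_ereal_def max_def min_def)+

lemma clamp_ereal_le: "a \<le> b \<Longrightarrow> t \<le> ereal a \<Longrightarrow> clamp_ereal a b t = a"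
  by (cases t) (auto simp: clamp_ereal_def max_def min_def)

lemma clamp_ereal_ge: "a \<le> b \<Longrightarrow> t \<ge> ereal b \<Longrightarrow> clamp_ereal a b t = b"
  by (cases t) (auto simp: clamp_ereal_def max_def min_def)

lemma continuous_on_clamp_ereal:
  assumes "a \<le> b"
  shows "continuous_on UNIV (clamp_ereal a b)"
  unfolding clamp_ereal_def
proof (rule continuous_on_compose2[OF continuous_on_real])
  show "continuous_on UNIV (\<lambda>t. max (ereal a) (min (ereal b) t))"
    by (intro continuous_on_max continuous_on_min continuous_on_const continuous_on_id)
  show "range (\<lambda>t. max (ereal a) (min (ereal b) t)) \<subseteq> UNIV - {\<infinity>, - \<infinity>}"
    by (auto simp: max_def min_def)
qed

lemma measurable_clamp_ereal [measurable]: "clamp_ereal a b \<in> borel_measurable borel"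
  unfolding clamp_ereal_def by measurable

text \<open>Piecewise linear, 0 up to a and 1 from b on: a continuous function lying between the
  indicators of \<open>{b..}\<close> and \<open>{a<..}\<close>.\<close>

definition ramp :: "real \<Rightarrow> real \<Rightarrow> ereal \<Rightarrow> real" where
  "ramp a b t = (clamp_ereal a b t - a) / (b - a)"

lemma ramp_eq_0: "a < b \<Longrightarrow> t \<le> ereal a \<Longrightarrow> ramp a b t = 0"
  by (simp add: ramp_def clamp_ereal_le)

lemma ramp_eq_1: "a < b \<Longrightarrow> t \<ge> ereal b \<Longrightarrow> ramp a b t = 1"
  by (simp add: ramp_def clamp_ereal_ge)

lemma ramp_bounds:
  assumes "a < b"
  shows "0 \<le> ramp a b t" "ramp a b t \<le> 1"
  using clamp_ereal_bounds[of a b t] assms by (auto simp: ramp_def divide_simps)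

lemma continuous_on_ramp: "a < b \<Longrightarrow> continuous_on UNIV (ramp a b)"
  unfolding ramp_def by (intro continuous_intros continuous_on_clamp_ereal) auto

lemma measurable_ramp [measurable]: "ramp a b \<in> borel_measurable borel"
  unfolding ramp_def by measurable

lemma continuous_on_abs_ereal: "continuous_on UNIV (abs :: ereal \<Rightarrow> ereal)"
proof -
  have "(abs :: ereal \<Rightarrow> ereal) = (\<lambda>t. max t (- t))"
  proof
    fix t :: ereal
    show "\<bar>t\<bar> = max t (- t)" by (cases t) (auto simp: max_def)
  qed
  then show ?thesis
    by (auto intro!: continuous_intros continuous_on_max)
qed


text \<open>All ramps vanish at 1 itself, so the limit is the indicator of the open half-line,
  matching the strict inequality in |X_0| > x.\<close>

lemma ramp_tendsto_indicator:
  "(\<lambda>n. ramp 1 (1 + inverse (real (Suc n))) t) \<longlonglongrightarrow> indicator {1<..} t"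
proof (cases "1 < t")
  case True
  have "(\<lambda>n. ereal (1 + inverse (real (Suc n)))) \<longlonglongrightarrow> ereal 1"
    using LIMSEQ_inverse_real_of_nat_add[of 1] by (intro tendsto_ereal) simp
  then have "eventually (\<lambda>n. ereal (1 + inverse (real (Suc n))) < t) sequentially"
    using True by (intro order_tendstoD(2)) (auto simp: one_ereal_def)
  then have "eventually (\<lambda>n. ramp 1 (1 + inverse (real (Suc n))) t = 1) sequentially"
    by eventually_elim (auto intro!: ramp_eq_1)
  with True show ?thesis
    by (simp add: tendsto_eventually)
next
  case False
  then have "ramp 1 (1 + inverse (real (Suc n))) t = 0" for n
    by (intro ramp_eq_0) (auto simp: one_ereal_def not_less)
  with False show ?thesis by simp
qed


section \<open>The punctured cone\<close>

abbreviation ext_topology :: "nat \<Rightarrow> (ereal \<times> (nat \<Rightarrow> ereal)) topology" where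
  "ext_topology s \<equiv> prod_topology euclidean (product_topology (\<lambda>_. euclidean) {0..s})"

definition origin :: "nat \<Rightarrow> ereal \<times> (nat \<Rightarrow> ereal)" where
  "origin s = (0, \<lambda>i\<in>{0..s}. 0)"

lemma topspace_cone_topology: "topspace (cone_topology s) = cone s"
  by (auto simp: cone_topology_def cone_def topspace_prod_topology)

lemma compact_space_ext_topology: "compact_space (ext_topology s)"
proof -
  have "compact_space (euclidean :: ereal topology)"
    using compact_UNIV[where 'a = ereal] by (simp add: compact_space_def)
  then show ?thesis
    by (auto simp only: compact_space_prod_topology compact_space_product_topology)
qed

text \<open>The extended space is compact, since infinity belongs to it. The superlevel set is
  closed there, and it misses the deleted origin because r vanishes at that point. In the
  applications r is z_0 or |z_i|.\<close>

lemma compactin_cone_superlevel: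
  fixes r :: "ereal \<times> (nat \<Rightarrow> ereal) \<Rightarrow> ereal"
  assumes r: "continuous_map (ext_topology s) euclidean r" and r0: "r (origin s) = 0" and a: "a > 0"
  shows "compactin (cone_topology s) {z \<in> cone s. ereal a \<le> r z}"
proof -
  have c1: "closedin (ext_topology s) {z \<in> topspace (ext_topology s). r z \<in> {ereal a..}}"
    by (rule closedin_continuous_map_preimage[OF r]) simp
  have c2: "closedin (ext_topology s) {z \<in> topspace (ext_topology s). fst z \<in> {0..}}"
    by (rule closedin_continuous_map_preimage[OF continuous_map_fst]) simp
  have "{z \<in> cone s. ereal a \<le> r z} =
      {z \<in> topspace (ext_topology s). r z \<in> {ereal a..}} \<inter>
      {z \<in> topspace (ext_topology s). fst z \<in> {0..}}"
    using r0 a by (auto simp: cone_def topspace_prod_topology origin_def)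
  then have "closedin (ext_topology s) {z \<in> cone s. ereal a \<le> r z}"
    using closedin_Int[OF c1 c2] by simp
  then show ?thesis
    unfolding cone_topology_def compactin_subtopology
    using compact_space_ext_topology closedin_compact_space by blast
qed

lemma continuous_map_coordinate:
  "i \<in> {0..s} \<Longrightarrow> continuous_map (ext_topology s) euclidean (\<lambda>z. snd z i)"
  using continuous_map_compose[OF continuous_map_snd
      continuous_map_product_projection[of i "{0..s}" "\<lambda>_. euclidean"]]
  by (simp add: o_def)

lemma continuous_map_abs_coordinate:
  "i \<in> {0..s} \<Longrightarrow> continuous_map (ext_topology s) euclidean (\<lambda>z. \<bar>snd z i\<bar>)"
  using continuous_map_compose[OF continuous_map_coordinate, of i s euclidean abs]
    continuous_on_abs_ereal
  by (simp add: o_def)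

lemma measurable_coordinate [measurable (raw)]:
  "i \<in> {0..s} \<Longrightarrow> (\<lambda>z. snd z i) \<in> borel_measurable (ext_borel s)"
  unfolding ext_borel_def by (rule measurable_compose[OF measurable_snd]) simp

lemma measurable_fst_ext_borel [measurable]: "fst \<in> borel_measurable (ext_borel s)"
  unfolding ext_borel_def by simp

lemma space_ext_borel: "space (ext_borel s) = UNIV \<times> (\<Pi>\<^sub>E i\<in>{0..s}. UNIV)"
  by (simp add: ext_borel_def space_pair_measure space_PiM)

lemma cone_subset_space: "cone s \<subseteq> space (ext_borel s)"
  by (auto simp: space_ext_borel cone_def)

lemma sets_cone [measurable]: "cone s \<in> sets (ext_borel s)"
proof -
  have "cone s = {z \<in> space (ext_borel s). 0 \<le> fst z \<and> \<not> (fst z = 0 \<and> (\<forall>i\<in>{0..s}. snd z i = 0))}"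
    by (auto simp: space_ext_borel cone_def PiE_iff extensional_def fun_eq_iff)
  also have "\<dots> \<in> sets (ext_borel s)"
    by measurable
  finally show ?thesis .
qed

text \<open>Product and Borel sigma-algebras are compared on the full function space over
  \<open>nat\<close>. Hence f is first extended to all functions by restricting the argument, and
  then pulled back along padding with zeros.\<close>

lemma measurable_continuous_map_vec:
  assumes f: "continuous_map (vec_topology s) euclideanreal f"
  shows "f \<in> borel_measurable (vec_borel s)"
proof -
  define F where "F y = f (\<lambda>i\<in>{0..s}. y i)" for y
  have "continuous_map euclidean (vec_topology s) (\<lambda>y::nat \<Rightarrow> real. \<lambda>i\<in>{0..s}. y i)"
    unfolding vec_topology_def continuous_map_componentwise
    by (auto intro: continuous_on_product_coordinates)
  from continuous_map_compose[OF this f] have "continuous_on UNIV F"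
    by (simp add: F_def o_def)
  then have F: "F \<in> borel_measurable (\<Pi>\<^sub>M i\<in>UNIV. borel)"
    using borel_measurable_continuous_onI measurable_cong_sets[OF sets_PiM_equal_borel refl] by blast
  have "(\<lambda>y i. if i \<in> {0..s} then y i else 0) \<in> measurable (vec_borel s) (\<Pi>\<^sub>M i\<in>UNIV. borel :: real measure)"
  proof (rule measurable_PiM_single')
    fix i :: nat
    show "(\<lambda>y. if i \<in> {0..s} then y i else 0) \<in> borel_measurable (vec_borel s)"
      unfolding vec_borel_def by (cases "i \<in> {0..s}") auto
  qed auto
  from measurable_compose[OF this F]
  have "(\<lambda>y. F (\<lambda>i. if i \<in> {0..s} then y i else 0)) \<in> borel_measurable (vec_borel s)" .
  moreover have "F (\<lambda>i. if i \<in> {0..s} then y i else 0) = f y" if "y \<in> space (vec_borel s)" for y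
    using that unfolding F_def
    by (auto simp: vec_borel_def space_PiM PiE_def extensional_def intro!: arg_cong[where f = f])
  ultimately show ?thesis
    by (simp cong: measurable_cong)
qed

section \<open>Regularly varying vectors\<close>

text \<open>The analytic core, detached from the time series: V stands for |X_0|, \<open>W i\<close>
  for Y_i, and D for the limiting ratio of their tails. U and \<open>\<nu>\<close> are fixed because
  every later constant is measured against them.\<close>

locale regularly_varying_vector = prob_space M
  for M :: "'a measure" +
  fixes s :: nat and V :: "'a \<Rightarrow> real" and W :: "nat \<Rightarrow> 'a \<Rightarrow> real" and \<alpha> D :: real
    and U :: "real \<Rightarrow> real" and \<nu> :: "(ereal \<times> (nat \<Rightarrow> ereal)) measure"
  assumes V_measurable [measurable]: "V \<in> borel_measurable M"
    and V_nonneg: "\<And>\<omega>. 0 \<le> V \<omega>"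
    and W_measurable [measurable]: "\<And>i. i \<in> {0..s} \<Longrightarrow> W i \<in> borel_measurable M"
    and alpha_pos: "\<alpha> > 0"
    and U_regular: "regularly_varying U (- \<alpha>)"
    and nu_radon: "nondegenerate_radon s \<nu>"
    and vague: "vague_convergence (cone_topology s)
        (\<lambda>x. scale_measure (ennreal (1 / U x)) (scaled_law M s V W x)) \<nu> at_top"
    and V_tail: "\<And>u. u > 0 \<Longrightarrow>
        ((\<lambda>x. \<P>(\<omega> in M. V \<omega> > u * x) / \<P>(\<omega> in M. V \<omega> > x)) \<longlongrightarrow> u powr (- \<alpha>)) at_top"
    and W_tail: "\<And>i. i \<in> {0..s} \<Longrightarrow>
        ((\<lambda>x. \<P>(\<omega> in M. \<bar>W i \<omega>\<bar> > x) / \<P>(\<omega> in M. V \<omega> > x)) \<longlongrightarrow> D) at_top"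
begin

section \<open>Vague convergence read as convergence of expectations\<close>

definition scaled :: "real \<Rightarrow> 'a \<Rightarrow> ereal \<times> (nat \<Rightarrow> ereal)" where
  "scaled x \<omega> = (ereal (V \<omega> / x), \<lambda>i\<in>{0..s}. ereal (W i \<omega> / x))"

lemma measurable_scaled [measurable]: "scaled x \<in> measurable M (ext_borel s)"
proof -
  have "(\<lambda>\<omega>. \<lambda>i\<in>{0..s}. ereal (W i \<omega> / x)) \<in> measurable M (\<Pi>\<^sub>M i\<in>{0..s}. borel)"
    by (intro measurable_restrict) measurable
  then show ?thesis
    unfolding scaled_def[abs_def] ext_borel_def by measurable
qed

lemma sets_nu [measurable_cong]: "sets \<nu> = sets (restrict_space (ext_borel s) (cone s))"
  using nu_radon by (simp add: nondegenerate_radon_def)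

lemma space_nu: "space \<nu> = cone s"
  using sets_eq_imp_space_eq[OF sets_nu] cone_subset_space[of s] by (auto simp: space_restrict_space)

lemma measurable_nu: "g \<in> measurable (ext_borel s) N \<Longrightarrow> g \<in> measurable \<nu> N"
  using measurable_restrict_space1 measurable_cong_sets[OF sets_nu refl] by blast

lemma sets_nu_iff: "A \<in> sets \<nu> \<longleftrightarrow> A \<in> sets (ext_borel s) \<and> A \<subseteq> cone s"
  by (auto simp: sets_nu sets_restrict_space_iff sets.Int_space_eq2 sets_cone)

lemma sets_nu_Collect:
  assumes "{z \<in> space (ext_borel s). P z} \<in> sets (ext_borel s)"
  shows "{z \<in> cone s. P z} \<in> sets \<nu>"
proof -
  have "{z \<in> cone s. P z} = cone s \<inter> {z \<in> space (ext_borel s). P z}"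
    using cone_subset_space by auto
  then show ?thesis
    using sets.Int[OF sets_cone assms] by (auto simp: sets_nu_iff)
qed

lemma U_nonneg: "x \<ge> 0 \<Longrightarrow> U x \<ge> 0"
  using U_regular by (simp add: regularly_varying_def)

text \<open>With 0 / 0 = 0, a zero of U would make U(x) / U(x) equal to 0, against its limit 1 (take
  \<tau> = 1). \<open>V_tail_pos\<close> rests on the same device.\<close>

lemma U_pos: "eventually (\<lambda>x. U x > 0) at_top"
proof -
  have "((\<lambda>x. U (1 * x) / U x) \<longlongrightarrow> 1 powr (- \<alpha>)) at_top"
    using U_regular unfolding regularly_varying_def by (blast intro: zero_less_one)
  then have "eventually (\<lambda>x. U x / U x > 0) at_top"
    using order_tendstoD(1)[of "\<lambda>x. U (1 * x) / U x" "1 powr (- \<alpha>)" at_top 0]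
    by (simp del: divide_self_if zero_less_divide_iff)
  with eventually_ge_at_top[of 0] show ?thesis
  proof eventually_elim
    case (elim x)
    then show ?case using U_nonneg[of x] by (cases "U x = 0") auto
  qed
qed

lemma V_tail_pos: "eventually (\<lambda>x. \<P>(\<omega> in M. V \<omega> > x) > 0) at_top"
proof -
  have "eventually (\<lambda>x. \<P>(\<omega> in M. V \<omega> > x) / \<P>(\<omega> in M. V \<omega> > x) > 0) at_top"
    using order_tendstoD(1)[OF V_tail[of 1], of 0] by simp
  then show ?thesis
    by eventually_elim (metis divide_self_if less_irrefl measure_nonneg order_le_less)
qed

text \<open>The scaled law only sees the cone, whereas the expectation runs over all of M. The two
  agree because g vanishes at the origin.\<close>

lemma vague_integral:
  assumes g: "continuous_map (cone_topology s) euclideanreal g"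
    and g_meas: "g \<in> borel_measurable (ext_borel s)"
    and K: "compactin (cone_topology s) K" "\<And>z. z \<in> cone s - K \<Longrightarrow> g z = 0"
    and g0: "g (origin s) = 0"
  shows "((\<lambda>x. expectation (\<lambda>\<omega>. g (scaled x \<omega>)) / U x) \<longlongrightarrow> (\<integral>z. g z \<partial>\<nu>)) at_top"
proof -
  have "((\<lambda>x. \<integral>z. g z \<partial>scale_measure (ennreal (1 / U x)) (scaled_law M s V W x))
      \<longlongrightarrow> (\<integral>z. g z \<partial>\<nu>)) at_top"
    using vague g K unfolding vague_convergence_def topspace_cone_topology by blast
  moreover have "eventually (\<lambda>x. (\<integral>z. g z \<partial>scale_measure (ennreal (1 / U x)) (scaled_law M s V W x))
      = expectation (\<lambda>\<omega>. g (scaled x \<omega>)) / U x) at_top"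
    using eventually_gt_at_top[of 0]
  proof eventually_elim
    case (elim x)
    let ?L = "scaled_law M s V W x"
    let ?d = "distr M (ext_borel s) (scaled x)"
    have L: "?L = restrict_space ?d (cone s)"
      by (simp add: scaled_law_def scaled_def[abs_def])
    have gL: "g \<in> borel_measurable ?L"
      unfolding L by (rule measurable_restrict_space1) (simp add: g_meas)
    \<comment> \<open>Scaling becomes a constant density, so that \<open>integral_density\<close>
      applies. If U(x) = 0, division by zero makes both sides 0.\<close>
    have "scale_measure (ennreal (1 / U x)) ?L = density ?L (\<lambda>_. ennreal (1 / U x))"
      by (rule measure_eqI) (auto simp: emeasure_density_const)
    then have "(\<integral>z. g z \<partial>scale_measure (ennreal (1 / U x)) ?L) = (\<integral>z. g z / U x \<partial>?L)"
      using integral_density[OF gL, of "\<lambda>_. 1 / U x"] U_nonneg[of x] elim by simp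
    also have "\<dots> = (\<integral>z. g z \<partial>?L) / U x"
      by simp
    also have "(\<integral>z. g z \<partial>?L) = (\<integral>z. indicator (cone s) z *\<^sub>R g z \<partial>?d)"
      unfolding L by (rule integral_restrict_space) (simp add: sets.Int_space_eq2[OF sets_cone])
    also have "\<dots> = expectation (\<lambda>\<omega>. indicator (cone s) (scaled x \<omega>) *\<^sub>R g (scaled x \<omega>))"
      using g_meas by (intro integral_distr) (auto intro!: borel_measurable_scaleR simp del: real_scaleR_def)
    also have "\<dots> = expectation (\<lambda>\<omega>. g (scaled x \<omega>))"
    proof (intro Bochner_Integration.integral_cong refl)
      fix \<omega>
      \<comment> \<open>For x > 0 and V \<ge> 0 the first coordinate is nonnegative, so the origin
        is the only point off the cone that can be hit.\<close>
      have "scaled x \<omega> \<in> cone s" if "scaled x \<omega> \<noteq> origin s"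
        using that elim V_nonneg[of \<omega>] by (auto simp: scaled_def cone_def origin_def)
      then show "indicator (cone s) (scaled x \<omega>) *\<^sub>R g (scaled x \<omega>) = g (scaled x \<omega>)"
        using g0 by (cases "scaled x \<omega> = origin s") auto
    qed
    finally show ?case .
  qed
  ultimately show ?thesis
    by (rule Lim_transform_eventually)
qed

lemma emeasure_superlevel_finite:
  fixes r :: "ereal \<times> (nat \<Rightarrow> ereal) \<Rightarrow> ereal"
  assumes "continuous_map (ext_topology s) euclidean r" "r (origin s) = 0" "a > 0"
  shows "emeasure \<nu> {z \<in> cone s. ereal a \<le> r z} < \<infinity>"
  using compactin_cone_superlevel[OF assms] nu_radon by (simp add: nondegenerate_radon_def)

lemma integrable_indicator_superlevel:
  fixes r :: "ereal \<times> (nat \<Rightarrow> ereal) \<Rightarrow> ereal"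
  assumes r: "continuous_map (ext_topology s) euclidean r" "r (origin s) = 0"
    and r_meas [measurable]: "r \<in> borel_measurable (ext_borel s)" and a: "a > 0"
  shows "integrable \<nu> (indicat_real {z \<in> cone s. ereal a \<le> r z})"
  using emeasure_superlevel_finite[OF r a]
  by (intro integrable_real_indicator) (auto intro!: sets_nu_Collect)

lemma integrable_ramp:
  fixes r :: "ereal \<times> (nat \<Rightarrow> ereal) \<Rightarrow> ereal"
  assumes r: "continuous_map (ext_topology s) euclidean r" "r (origin s) = 0"
    and r_meas: "r \<in> borel_measurable (ext_borel s)" and ab: "0 < a" "a < b"
  shows "integrable \<nu> (\<lambda>z. ramp a b (r z))"
proof (rule Bochner_Integration.integrable_bound[OF integrable_indicator_superlevel[OF r r_meas ab(1)]])
  show "(\<lambda>z. ramp a b (r z)) \<in> borel_measurable \<nu>"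
    by (rule measurable_compose[OF measurable_nu[OF r_meas]]) measurable
  show "AE z in \<nu>. norm (ramp a b (r z)) \<le> norm (indicat_real {z \<in> cone s. ereal a \<le> r z} z)"
    using ramp_bounds[OF ab(2)] ramp_eq_0[OF ab(2)]
    by (intro AE_I2) (auto simp: space_nu indicator_def not_le)
qed

lemma vague_ramp:
  fixes r :: "ereal \<times> (nat \<Rightarrow> ereal) \<Rightarrow> ereal"
  assumes r: "continuous_map (ext_topology s) euclidean r" "r (origin s) = 0"
    and r_meas: "r \<in> borel_measurable (ext_borel s)" and ab: "0 < a" "a < b"
  shows "((\<lambda>x. expectation (\<lambda>\<omega>. ramp a b (r (scaled x \<omega>))) / U x) \<longlongrightarrow> (\<integral>z. ramp a b (r z) \<partial>\<nu>)) at_top"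
proof (rule vague_integral)
  show "continuous_map (cone_topology s) euclideanreal (\<lambda>z. ramp a b (r z))"
    using continuous_map_compose[OF r(1), of euclideanreal "ramp a b"] continuous_on_ramp[OF ab(2)]
    unfolding cone_topology_def by (intro continuous_map_from_subtopology) (simp add: o_def)
  show "(\<lambda>z. ramp a b (r z)) \<in> borel_measurable (ext_borel s)"
    by (rule measurable_compose[OF r_meas]) measurable
  show "compactin (cone_topology s) {z \<in> cone s. ereal a \<le> r z}"
    by (rule compactin_cone_superlevel[OF r ab(1)])
  show "ramp a b (r z) = 0" if "z \<in> cone s - {z \<in> cone s. ereal a \<le> r z}" for z
    using that by (intro ramp_eq_0 ab) auto
  show "ramp a b (r (origin s)) = 0"
    using r ab by (intro ramp_eq_0) auto
qed

lemma expectation_ramp_bounds: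
  fixes r :: "ereal \<times> (nat \<Rightarrow> ereal) \<Rightarrow> ereal"
  assumes r_meas [measurable]: "r \<in> borel_measurable (ext_borel s)" and ab: "a < b"
  shows "\<P>(\<omega> in M. r (scaled x \<omega>) > ereal b) \<le> expectation (\<lambda>\<omega>. ramp a b (r (scaled x \<omega>)))"
    and "expectation (\<lambda>\<omega>. ramp a b (r (scaled x \<omega>))) \<le> \<P>(\<omega> in M. r (scaled x \<omega>) > ereal a)"
proof -
  have int: "integrable M (\<lambda>\<omega>. ramp a b (r (scaled x \<omega>)))"
    using ramp_bounds[OF ab] by (intro integrable_const_bound[where B = 1]) auto
  have "expectation (indicator {\<omega> \<in> space M. r (scaled x \<omega>) > ereal b})
      \<le> expectation (\<lambda>\<omega>. ramp a b (r (scaled x \<omega>)))"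
    using ramp_bounds[OF ab] ramp_eq_1[OF ab] int
    by (intro integral_mono integrable_real_indicator) (auto simp: indicator_def emeasure_eq_measure)
  then show "\<P>(\<omega> in M. r (scaled x \<omega>) > ereal b) \<le> expectation (\<lambda>\<omega>. ramp a b (r (scaled x \<omega>)))"
    by simp
  have "expectation (\<lambda>\<omega>. ramp a b (r (scaled x \<omega>)))
      \<le> expectation (indicator {\<omega> \<in> space M. r (scaled x \<omega>) > ereal a})"
    using ramp_bounds[OF ab] ramp_eq_0[OF ab] int
    by (intro integral_mono integrable_real_indicator) (auto simp: indicator_def emeasure_eq_measure not_less)
  then show "expectation (\<lambda>\<omega>. ramp a b (r (scaled x \<omega>))) \<le> \<P>(\<omega> in M. r (scaled x \<omega>) > ereal a)"
    by simp
qed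

text \<open>A ramp from a to b fits between the two events: it dominates the indicator of r \<ge> b
  under \<open>\<nu>\<close>, and is dominated by that of r > a before the limit. The gap a < b
  avoids any condition on the boundary.\<close>

lemma measure_superlevel_le:
  fixes r :: "ereal \<times> (nat \<Rightarrow> ereal) \<Rightarrow> ereal"
  assumes r: "continuous_map (ext_topology s) euclidean r" "r (origin s) = 0"
    and r_meas: "r \<in> borel_measurable (ext_borel s)" and ab: "0 < a" "a < b"
    and lim: "((\<lambda>x. \<P>(\<omega> in M. r (scaled x \<omega>) > ereal a) / U x) \<longlongrightarrow> l) at_top"
  shows "measure \<nu> {z \<in> cone s. ereal b \<le> r z} \<le> l"
proof -
  have b: "b > 0" using ab by simp
  have "measure \<nu> {z \<in> cone s. ereal b \<le> r z} = (\<integral>z. indicator {z \<in> cone s. ereal b \<le> r z} z \<partial>\<nu>)"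
    by (simp add: Int_absorb2 space_nu Collect_mono)
  also have "\<dots> \<le> (\<integral>z. ramp a b (r z) \<partial>\<nu>)"
    using ramp_bounds[OF ab(2)] ramp_eq_1[OF ab(2)]
    by (intro integral_mono integrable_indicator_superlevel integrable_ramp r r_meas ab b) (auto simp: indicator_def)
  also have "\<dots> \<le> l"
  proof (rule tendsto_le[OF _ lim vague_ramp[OF r r_meas ab]])
    show "\<forall>\<^sub>F x in at_top. expectation (\<lambda>\<omega>. ramp a b (r (scaled x \<omega>))) / U x
        \<le> \<P>(\<omega> in M. r (scaled x \<omega>) > ereal a) / U x"
      using U_pos by eventually_elim (intro divide_right_mono expectation_ramp_bounds r_meas ab, simp)
  qed simp
  finally show ?thesis .
qed

section \<open>Tails of V and W measured against U\<close>

lemma scaled_fst_iff: "x > 0 \<Longrightarrow> ereal a < fst (scaled x \<omega>) \<longleftrightarrow> a * x < V \<omega>"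
  by (simp add: scaled_def field_simps)

lemma scaled_snd_iff:
  "x > 0 \<Longrightarrow> i \<in> {0..s} \<Longrightarrow> ereal a < \<bar>snd (scaled x \<omega>) i\<bar> \<longleftrightarrow> a * x < \<bar>W i \<omega>\<bar>"
  by (simp add: scaled_def field_simps)

text \<open>The constant c of the overview. It is a genuine mass: {z_0 \<ge> 1} is compact in the
  cone, hence of finite measure.\<close>

definition tail_mass :: real where
  "tail_mass = measure \<nu> {z \<in> cone s. 1 < fst z}"

lemma sets_fst_gt [measurable]: "{z \<in> cone s. 1 < fst z} \<in> sets \<nu>"
  by (rule sets_nu_Collect) measurable

lemma emeasure_fst_gt: "emeasure \<nu> {z \<in> cone s. 1 < fst z} < \<infinity>"
proof -
  have "emeasure \<nu> {z \<in> cone s. 1 < fst z} \<le> emeasure \<nu> {z \<in> cone s. ereal 1 \<le> fst z}"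
    by (intro emeasure_mono sets_nu_Collect) (auto simp: one_ereal_def, measurable)
  also have "\<dots> < \<infinity>"
    by (rule emeasure_superlevel_finite) (auto simp: origin_def continuous_map_fst)
  finally show ?thesis .
qed

lemma ramp_integral_tendsto:
  "(\<lambda>n. \<integral>z. ramp 1 (1 + inverse (real (Suc n))) (fst z) \<partial>\<nu>) \<longlonglongrightarrow> tail_mass"
proof -
  have "(\<lambda>n. \<integral>z. ramp 1 (1 + inverse (real (Suc n))) (fst z) \<partial>\<nu>)
      \<longlonglongrightarrow> (\<integral>z. indicator {z \<in> cone s. 1 < fst z} z \<partial>\<nu>)"
  proof (rule integral_dominated_convergence[where w = "indicator {z \<in> cone s. ereal 1 \<le> fst z}"])
    show "integrable \<nu> (indicat_real {z \<in> cone s. ereal 1 \<le> fst z})"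
      by (rule integrable_indicator_superlevel) (auto simp: origin_def continuous_map_fst)
    show "AE z in \<nu>. (\<lambda>n. ramp 1 (1 + inverse (real (Suc n))) (fst z))
        \<longlonglongrightarrow> indicator {z \<in> cone s. 1 < fst z} z"
      using ramp_tendsto_indicator by (intro AE_I2) (auto simp: space_nu indicator_def)
    show "AE z in \<nu>. norm (ramp 1 (1 + inverse (real (Suc n))) (fst z))
        \<le> indicator {z \<in> cone s. ereal 1 \<le> fst z} z" for n
      using ramp_bounds[of 1 "1 + inverse (real (Suc n))"] ramp_eq_0[of 1 "1 + inverse (real (Suc n))"]
      by (intro AE_I2) (auto simp: space_nu indicator_def not_le)
    show "(\<lambda>z. ramp 1 (1 + inverse (real (Suc n))) (fst z)) \<in> borel_measurable \<nu>" for n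
      by (rule measurable_compose[OF measurable_nu[OF measurable_fst_ext_borel]]) measurable
  qed (simp add: sets_fst_gt)
  also have "(\<integral>z. indicator {z \<in> cone s. 1 < fst z} z \<partial>\<nu>) = tail_mass"
    by (simp add: tail_mass_def Int_absorb2 space_nu Collect_mono)
  finally show ?thesis .
qed

text \<open>The expectation of a ramp from 1 to b lies between P(V > b x) and P(V > x), so it bounds
  the latter only from below. Regular variation of the tail of V closes the gap at the price of the
  factor b^\<alpha>, which tends to 1 with b.\<close>

lemma V_tail_U: "((\<lambda>x. \<P>(\<omega> in M. V \<omega> > x) / U x) \<longlongrightarrow> tail_mass) at_top"
proof -
  define b where "b n = 1 + inverse (real (Suc n))" for n
  define L where "L n = (\<integral>z. ramp 1 (b n) (fst z) \<partial>\<nu>)" for n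
  define I where "I n x = expectation (\<lambda>\<omega>. ramp 1 (b n) (fst (scaled x \<omega>))) / U x" for n x
  define \<rho> where "\<rho> n x = \<P>(\<omega> in M. V \<omega> > b n * x) / \<P>(\<omega> in M. V \<omega> > x)" for n x
  have b1: "b n > 1" for n by (simp add: b_def)
  have b: "b \<longlonglongrightarrow> 1"
    unfolding b_def using LIMSEQ_inverse_real_of_nat_add[of 1] by simp
  have L: "L \<longlonglongrightarrow> tail_mass"
    unfolding L_def b_def by (rule ramp_integral_tendsto)
  \<comment> \<open>These are the limits in x of the upper bounds \<open>I n x / \<rho> n x\<close>;
    since b n tends to 1, they too approach c.\<close>
  have "(\<lambda>n. L n / b n powr (- \<alpha>)) \<longlonglongrightarrow> tail_mass / 1 powr (- \<alpha>)"
    by (intro tendsto_intros L b) auto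
  then have L': "(\<lambda>n. L n / b n powr (- \<alpha>)) \<longlonglongrightarrow> tail_mass" by simp
  have I: "(I n \<longlongrightarrow> L n) at_top" for n
    unfolding I_def L_def using b1[of n]
    by (intro vague_ramp continuous_map_fst) (auto simp: origin_def)
  have \<rho>: "(\<rho> n \<longlongrightarrow> b n powr (- \<alpha>)) at_top" for n
    unfolding \<rho>_def by (rule V_tail) (use b1[of n] in simp)
  have lower: "eventually (\<lambda>x. I n x \<le> \<P>(\<omega> in M. V \<omega> > x) / U x) at_top" for n
    using U_pos eventually_gt_at_top[of 0]
  proof eventually_elim
    case (elim x)
    then show ?case
      using expectation_ramp_bounds(2)[of fst 1 "b n" x] b1[of n] scaled_fst_iff[of x 1]
      unfolding I_def by (intro divide_right_mono) auto
  qed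
  have upper: "eventually (\<lambda>x. \<P>(\<omega> in M. V \<omega> > x) / U x \<le> I n x / \<rho> n x) at_top" for n
  proof -
    have "eventually (\<lambda>x. \<rho> n x > 0) at_top"
      using b1[of n] by (intro order_tendstoD(1)[OF \<rho>]) simp
    then show ?thesis
      using U_pos eventually_gt_at_top[of 0] V_tail_pos
    proof eventually_elim
      case (elim x)
      have "\<rho> n x * \<P>(\<omega> in M. V \<omega> > x) = \<P>(\<omega> in M. V \<omega> > b n * x)"
        using elim(4) by (simp add: \<rho>_def)
      also have "\<dots> \<le> expectation (\<lambda>\<omega>. ramp 1 (b n) (fst (scaled x \<omega>)))"
        using expectation_ramp_bounds(1)[of fst 1 "b n" x] b1[of n] scaled_fst_iff[OF elim(3), of "b n"]
        by auto
      also have "\<dots> = I n x * U x"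
        using elim(2) by (simp add: I_def)
      finally show ?case
        using elim(1,2) by (simp add: field_simps)
    qed
  qed
  show ?thesis
  proof (rule order_tendstoI)
    fix y assume "y < tail_mass"
    with order_tendstoD(1)[OF L] obtain n where "y < L n"
      by (auto simp: eventually_sequentially)
    then have "eventually (\<lambda>x. y < I n x) at_top"
      by (rule order_tendstoD(1)[OF I])
    with lower[of n] show "eventually (\<lambda>x. y < \<P>(\<omega> in M. V \<omega> > x) / U x) at_top"
      by eventually_elim simp
  next
    fix y assume "tail_mass < y"
    with order_tendstoD(2)[OF L'] obtain n where n: "L n / b n powr (- \<alpha>) < y"
      by (auto simp: eventually_sequentially)
    have "((\<lambda>x. I n x / \<rho> n x) \<longlongrightarrow> L n / b n powr (- \<alpha>)) at_top"
      using b1[of n] by (intro tendsto_divide I \<rho>) simp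
    then have "eventually (\<lambda>x. I n x / \<rho> n x < y) at_top"
      using n by (rule order_tendstoD(2))
    with upper[of n] show "eventually (\<lambda>x. \<P>(\<omega> in M. V \<omega> > x) / U x < y) at_top"
      by eventually_elim simp
  qed
qed

lemma V_tail_scaled:
  assumes "a > 0"
  shows "((\<lambda>x. \<P>(\<omega> in M. V \<omega> > a * x) / U x) \<longlongrightarrow> a powr (- \<alpha>) * tail_mass) at_top"
  using tendsto_mult[OF V_tail[OF assms] V_tail_U]
  by (rule Lim_transform_eventually) (use V_tail_pos in eventually_elim, simp)

text \<open>The tail ratio is evaluated at a x instead of x. This trades the tail of W for that of V
  at the same level, where \<open>V_tail_scaled\<close> applies.\<close>

lemma W_tail_scaled:
  assumes "a > 0" "i \<in> {0..s}"
  shows "((\<lambda>x. \<P>(\<omega> in M. \<bar>W i \<omega>\<bar> > a * x) / U x) \<longlongrightarrow> D * (a powr (- \<alpha>) * tail_mass)) at_top"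
proof -
  have ax: "filterlim (\<lambda>x. a * x) at_top at_top"
    using assms by (intro filterlim_tendsto_pos_mult_at_top[OF tendsto_const]) (auto simp: filterlim_ident)
  have "eventually (\<lambda>x. \<P>(\<omega> in M. V \<omega> > a * x) > 0) at_top"
    using V_tail_pos ax by (auto simp: filterlim_iff)
  then have "eventually (\<lambda>x. \<P>(\<omega> in M. \<bar>W i \<omega>\<bar> > a * x) / \<P>(\<omega> in M. V \<omega> > a * x) *
      (\<P>(\<omega> in M. V \<omega> > a * x) / U x) = \<P>(\<omega> in M. \<bar>W i \<omega>\<bar> > a * x) / U x) at_top"
    by eventually_elim simp
  with tendsto_mult[OF filterlim_compose[OF W_tail[OF assms(2)] ax] V_tail_scaled[OF assms(1)]]
  show ?thesis
    by (rule Lim_transform_eventually)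
qed

section \<open>Mass bounds for the limit measure: positivity and no mass at infinity\<close>

lemma measure_fst_ge_le:
  assumes "0 < a" "a < b"
  shows "measure \<nu> {z \<in> cone s. ereal b \<le> fst z} \<le> a powr (- \<alpha>) * tail_mass"
proof (rule measure_superlevel_le[OF _ _ _ assms])
  show "((\<lambda>x. \<P>(\<omega> in M. fst (scaled x \<omega>) > ereal a) / U x) \<longlongrightarrow> a powr (- \<alpha>) * tail_mass) at_top"
    using V_tail_scaled[OF assms(1)]
    by (rule Lim_transform_eventually)
       (use eventually_gt_at_top[of 0] in eventually_elim, simp add: scaled_fst_iff)
qed (auto simp: origin_def continuous_map_fst)

lemma measure_snd_ge_le:
  assumes "0 < a" "a < b" and i: "i \<in> {0..s}"
  shows "measure \<nu> {z \<in> cone s. ereal b \<le> \<bar>snd z i\<bar>} \<le> D * (a powr (- \<alpha>) * tail_mass)"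
proof (rule measure_superlevel_le[OF continuous_map_abs_coordinate[OF i] _ _ assms(1,2)])
  show "((\<lambda>x. \<P>(\<omega> in M. \<bar>snd (scaled x \<omega>) i\<bar> > ereal a) / U x) \<longlongrightarrow> D * (a powr (- \<alpha>) * tail_mass)) at_top"
    using W_tail_scaled[OF assms(1) i]
    by (rule Lim_transform_eventually)
       (use eventually_gt_at_top[of 0] in eventually_elim, simp add: scaled_snd_iff[OF _ i])
  show "(\<lambda>z. \<bar>snd z i\<bar>) \<in> borel_measurable (ext_borel s)"
    using i by measurable
qed (use i in \<open>simp add: origin_def\<close>)

text \<open>A set of infinite mass also has \<open>measure\<close> 0; finiteness on compact sets is
  what turns the bound into nullity.\<close>

lemma superlevel_null:
  fixes r :: "ereal \<times> (nat \<Rightarrow> ereal) \<Rightarrow> ereal"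
  assumes r: "continuous_map (ext_topology s) euclidean r" "r (origin s) = 0"
    and r_meas [measurable]: "r \<in> borel_measurable (ext_borel s)" and b: "b > 0"
    and le: "measure \<nu> {z \<in> cone s. ereal b \<le> r z} \<le> 0"
  shows "{z \<in> cone s. ereal b \<le> r z} \<in> null_sets \<nu>"
proof (rule null_setsI)
  show "emeasure \<nu> {z \<in> cone s. ereal b \<le> r z} = 0"
    using emeasure_superlevel_finite[OF r b] le
    by (subst emeasure_eq_ennreal_measure) (auto simp: measure_le_0_iff)
  show "{z \<in> cone s. ereal b \<le> r z} \<in> sets \<nu>"
    by (rule sets_nu_Collect) measurable
qed

lemma tail_mass_pos: "tail_mass > 0"
proof (rule ccontr)
  assume "\<not> tail_mass > 0"
  then have tail_mass: "tail_mass = 0"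
    by (simp add: tail_mass_def zero_less_measure_iff)
  define b where "b n = inverse (real (Suc n))" for n
  have b: "b n > 0" for n by (simp add: b_def)
  \<comment> \<open>The level is halved to leave the strict gap that the mass bounds
    require.\<close>
  have fst_null: "{z \<in> cone s. ereal (b n) \<le> fst z} \<in> null_sets \<nu>" for n
    using measure_fst_ge_le[of "b n / 2" "b n"] b[of n] tail_mass
    by (intro superlevel_null) (auto simp: origin_def continuous_map_fst)
  have snd_null: "{z \<in> cone s. ereal (b n) \<le> \<bar>snd z i\<bar>} \<in> null_sets \<nu>" if i: "i \<in> {0..s}" for n i
  proof (rule superlevel_null[OF continuous_map_abs_coordinate[OF i] _ _ b])
    show "(\<lambda>z. \<bar>snd z i\<bar>) \<in> borel_measurable (ext_borel s)"
      using i by measurable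
    show "measure \<nu> {z \<in> cone s. ereal (b n) \<le> \<bar>snd z i\<bar>} \<le> 0"
      using measure_snd_ge_le[of "b n / 2" "b n" i] b[of n] i tail_mass by simp
  qed (use i in \<open>simp add: origin_def\<close>)
  \<comment> \<open>A countable cover of the cone: a point other than the origin has some coordinate
    of absolute value at least 1 / (n + 1) for suitable n.\<close>
  define A where "A = (\<Union>n. {z \<in> cone s. ereal (b n) \<le> fst z} \<union>
      (\<Union>i\<in>{0..s}. {z \<in> cone s. ereal (b n) \<le> \<bar>snd z i\<bar>}))"
  have sub: "cone s \<subseteq> A"
  proof
    fix z assume z: "z \<in> cone s"
    have "0 < fst z \<or> (\<exists>i\<in>{0..s}. 0 < \<bar>snd z i\<bar>)"
    proof (rule ccontr)
      assume *: "\<not> ?thesis"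
      have "t = 0" if "\<not> 0 < \<bar>t\<bar>" for t :: ereal
        using that by (cases t) auto
      with * have "snd z i = 0" if "i \<in> {0..s}" for i
        using that by blast
      moreover have "fst z = 0"
        using * z by (auto simp: cone_def)
      moreover have "snd z \<in> extensional {0..s}"
        using z by (auto simp: cone_def PiE_def)
      ultimately have "z = (0, \<lambda>i\<in>{0..s}. 0)"
        by (intro prod_eqI) (auto simp: extensional_def)
      with z show False
        by (simp add: cone_def)
    qed
    moreover have "\<exists>n. ereal (b n) \<le> t" if "0 < t" for t :: ereal
    proof -
      have "b \<longlonglongrightarrow> 0"
        unfolding b_def by (rule LIMSEQ_inverse_real_of_nat)
      then have "(\<lambda>n. ereal (b n)) \<longlonglongrightarrow> ereal 0"
        by (rule tendsto_ereal)
      then have "eventually (\<lambda>n. ereal (b n) < t) sequentially"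
        using that by (intro order_tendstoD(2)) (auto simp: zero_ereal_def)
      then show ?thesis
        by (auto simp: eventually_sequentially intro: less_imp_le)
    qed
    ultimately show "z \<in> A"
      unfolding A_def using z by blast
  qed
  have cone: "cone s \<in> sets \<nu>"
    using sets.top[of \<nu>] by (simp add: space_nu)
  have "A \<in> null_sets \<nu>"
    unfolding A_def by (intro null_sets_UN null_sets.Un null_sets_UN' fst_null snd_null) auto
  then have "cone s \<in> null_sets \<nu>"
    using cone sub by (rule null_sets_subset)
  then show False
    using nu_radon by (auto simp: nondegenerate_radon_def)
qed

lemma AE_nu_finite: "AE z in \<nu>. \<forall>i\<in>{0..s}. \<bar>snd z i\<bar> \<noteq> \<infinity>"
proof -
  have "AE z in \<nu>. \<bar>snd z i\<bar> \<noteq> \<infinity>" if i: "i \<in> {0..s}" for i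
  proof -
    \<comment> \<open>The levels exceed n + 1 by one, so the bound with a = n + 1 applies; it is
      positive and yields a mass of order (n + 1)^(-\<alpha>).\<close>
    define R where "R n = {z \<in> cone s. ereal (real (Suc n) + 1) \<le> \<bar>snd z i\<bar>}" for n
    have R: "R n \<in> sets \<nu>" for n
      unfolding R_def using i by (intro sets_nu_Collect) measurable
    have fin: "emeasure \<nu> (R n) < \<infinity>" for n
      unfolding R_def
      by (rule emeasure_superlevel_finite[OF continuous_map_abs_coordinate[OF i]])
        (use i in \<open>auto simp: origin_def\<close>)
    let ?I = "{z \<in> cone s. \<bar>snd z i\<bar> = \<infinity>}"
    have I: "?I \<in> sets \<nu>"
      using i by (intro sets_nu_Collect) measurable
    have sub: "?I \<subseteq> R n" for n
      by (auto simp: R_def)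
    have "measure \<nu> ?I \<le> D * (real (Suc n) powr (- \<alpha>) * tail_mass)" for n
    proof -
      have "measure \<nu> ?I \<le> measure \<nu> (R n)"
        using fin[of n] R[of n] I sub[of n] by (intro measure_mono_fmeasurable fmeasurableI) auto
      also have "\<dots> \<le> D * (real (Suc n) powr (- \<alpha>) * tail_mass)"
        unfolding R_def by (rule measure_snd_ge_le) (use i in auto)
      finally show ?thesis .
    qed
    moreover have "(\<lambda>n. D * (real (Suc n) powr (- \<alpha>) * tail_mass)) \<longlonglongrightarrow> D * (0 * tail_mass)"
      using alpha_pos
      by (intro tendsto_intros tendsto_neg_powr filterlim_compose[OF filterlim_real_sequentially filterlim_Suc]) auto
    ultimately have "measure \<nu> ?I \<le> 0"
      by (intro LIMSEQ_le_const[of _ 0]) auto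
    moreover have "emeasure \<nu> ?I < \<infinity>"
      using emeasure_mono[OF sub[of 0] R[of 0]] fin[of 0] by (rule le_less_trans)
    ultimately have "emeasure \<nu> ?I = 0"
      by (subst emeasure_eq_ennreal_measure) (auto simp: measure_le_0_iff)
    with I have "?I \<in> null_sets \<nu>" by (intro null_setsI)
    then show ?thesis
      by (rule AE_I') (auto simp: space_nu)
  qed
  then show ?thesis
    by (subst AE_finite_all) auto
qed

section \<open>Bounded cut-off test functions and their errors\<close>

definition real_part :: "ereal \<times> (nat \<Rightarrow> ereal) \<Rightarrow> nat \<Rightarrow> real" where
  "real_part z = (\<lambda>i\<in>{0..s}. real_of_ereal (snd z i))"

text \<open>\<open>real_part\<close> sends infinite coordinates to 0 and is discontinuous there.
  This is its continuous substitute, equal to it wherever all coordinates are at most a in absolute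
  value.\<close>

definition clamp_part :: "real \<Rightarrow> ereal \<times> (nat \<Rightarrow> ereal) \<Rightarrow> nat \<Rightarrow> real" where
  "clamp_part a z = (\<lambda>i\<in>{0..s}. clamp_ereal (- a) a (snd z i))"

lemma measurable_real_part [measurable]: "real_part \<in> measurable (ext_borel s) (vec_borel s)"
  unfolding real_part_def[abs_def] vec_borel_def by (intro measurable_restrict) measurable

lemma measurable_clamp_part [measurable]: "clamp_part a \<in> measurable (ext_borel s) (vec_borel s)"
  unfolding clamp_part_def[abs_def] vec_borel_def by (intro measurable_restrict) measurable

lemma continuous_map_clamp_part:
  assumes "a \<ge> 0"
  shows "continuous_map (ext_topology s) (vec_topology s) (clamp_part a)"
  unfolding vec_topology_def continuous_map_componentwise
proof (intro conjI ballI)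
  show "clamp_part a ` topspace (ext_topology s) \<subseteq> extensional {0..s}"
    by (auto simp: clamp_part_def)
  fix i assume i: "i \<in> {0..s}"
  have "continuous_map euclidean euclideanreal (clamp_ereal (- a) a)"
    using continuous_on_clamp_ereal[of "- a" a] assms by simp
  from continuous_map_compose[OF continuous_map_coordinate[OF i] this]
  show "continuous_map (ext_topology s) euclideanreal (\<lambda>z. clamp_part a z i)"
    using i by (simp add: o_def clamp_part_def)
qed

lemma clamp_part_eq_real_part:
  assumes "a \<ge> 0" "\<And>i. i \<in> {0..s} \<Longrightarrow> \<bar>snd z i\<bar> \<le> ereal a"
  shows "clamp_part a z = real_part z"
  unfolding clamp_part_def real_part_def
proof (rule restrict_ext)
  fix i assume "i \<in> {0..s}"
  with assms(2)[of i] assms(1) show "clamp_ereal (- a) a (snd z i) = real_of_ereal (snd z i)"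
    by (cases "snd z i") (auto simp: clamp_ereal_ereal)
qed

lemma real_part_scaled: "real_part (scaled x \<omega>) = (\<lambda>i\<in>{0..s}. W i \<omega> / x)"
  by (auto simp: real_part_def scaled_def)

text \<open>One index drives both approximations: the ramp has width 1 / (n + 1) and the clamp acts
  at level n + 1, so a single limit in n removes both.\<close>

definition cutoff :: "((nat \<Rightarrow> real) \<Rightarrow> real) \<Rightarrow> nat \<Rightarrow> ereal \<times> (nat \<Rightarrow> ereal) \<Rightarrow> real" where
  "cutoff f n z = ramp 1 (1 + inverse (real (Suc n))) (fst z) * f (clamp_part (real (Suc n)) z)"

context
  fixes f :: "(nat \<Rightarrow> real) \<Rightarrow> real" and B :: real
  assumes f: "continuous_map (vec_topology s) euclideanreal f"
    and f_bound: "\<And>y. y \<in> topspace (vec_topology s) \<Longrightarrow> \<bar>f y\<bar> \<le> B"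
begin

lemma f_measurable [measurable]: "f \<in> borel_measurable (vec_borel s)"
  by (rule measurable_continuous_map_vec[OF f])

lemma f_real_part_bound: "\<bar>f (real_part z)\<bar> \<le> B"
  by (rule f_bound) (simp add: real_part_def vec_topology_def)

lemma f_clamp_part_bound: "\<bar>f (clamp_part a z)\<bar> \<le> B"
  by (rule f_bound) (simp add: clamp_part_def vec_topology_def)

lemma B_nonneg: "B \<ge> 0"
  using f_real_part_bound[of undefined] by linarith

lemma cutoff_measurable [measurable]: "cutoff f n \<in> borel_measurable (ext_borel s)"
  unfolding cutoff_def[abs_def] by measurable

lemma cutoff_bound: "\<bar>cutoff f n z\<bar> \<le> B"
proof -
  have "\<bar>cutoff f n z\<bar> \<le> 1 * B"
    unfolding cutoff_def abs_mult
    using ramp_bounds[of 1 "1 + inverse (real (Suc n))" "fst z"]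
    by (intro mult_mono f_clamp_part_bound) auto
  then show ?thesis by simp
qed

lemma cutoff_eq_0: "fst z \<le> 1 \<Longrightarrow> cutoff f n z = 0"
  by (simp add: cutoff_def ramp_eq_0 one_ereal_def)

lemma vague_cutoff:
  "((\<lambda>x. expectation (\<lambda>\<omega>. cutoff f n (scaled x \<omega>)) / U x) \<longlongrightarrow> (\<integral>z. cutoff f n z \<partial>\<nu>)) at_top"
proof (rule vague_integral[OF _ cutoff_measurable])
  let ?b = "1 + inverse (real (Suc n))"
  have "continuous_map (ext_topology s) euclideanreal (\<lambda>z. ramp 1 ?b (fst z))"
    using continuous_map_compose[OF continuous_map_fst, of euclidean euclideanreal "ramp 1 ?b"]
      continuous_on_ramp[of 1 ?b]
    by (simp add: o_def)
  moreover have "continuous_map (ext_topology s) euclideanreal (\<lambda>z. f (clamp_part (real (Suc n)) z))"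
    using continuous_map_compose[OF continuous_map_clamp_part f, of "real (Suc n)"] by (simp add: o_def)
  ultimately show "continuous_map (cone_topology s) euclideanreal (cutoff f n)"
    unfolding cone_topology_def cutoff_def[abs_def]
    by (intro continuous_map_from_subtopology continuous_map_real_mult)
  show "compactin (cone_topology s) {z \<in> cone s. ereal 1 \<le> fst z}"
    by (rule compactin_cone_superlevel) (auto simp: origin_def continuous_map_fst)
  show "cutoff f n z = 0" if "z \<in> cone s - {z \<in> cone s. ereal 1 \<le> fst z}" for z
    using that by (intro cutoff_eq_0) (auto simp: one_ereal_def)
  show "cutoff f n (origin s) = 0"
    by (rule cutoff_eq_0) (simp add: origin_def)
qed

text \<open>Dominated convergence: all cut-offs live on {z_0 \<ge> 1}, which has finite mass, and at
  a point with finite coordinates the clamp is eventually inactive. \<open>AE_nu_finite\<close>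
  supplies such points almost everywhere.\<close>

lemma cutoff_integral_tendsto:
  "(\<lambda>n. \<integral>z. cutoff f n z \<partial>\<nu>) \<longlonglongrightarrow> (\<integral>z. indicator {1<..} (fst z) * f (real_part z) \<partial>\<nu>)"
proof (rule integral_dominated_convergence[where w = "\<lambda>z. B * indicator {z \<in> cone s. ereal 1 \<le> fst z} z"])
  show "integrable \<nu> (\<lambda>z. B * indicat_real {z \<in> cone s. ereal 1 \<le> fst z} z)"
    by (intro integrable_mult_right integrable_indicator_superlevel) (auto simp: origin_def continuous_map_fst)
  show "(\<lambda>z. indicator {1<..} (fst z) * f (real_part z)) \<in> borel_measurable \<nu>"
    by (rule measurable_nu) measurable
  show "cutoff f n \<in> borel_measurable \<nu>" for n
    by (rule measurable_nu[OF cutoff_measurable])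
  show "AE z in \<nu>. norm (cutoff f n z) \<le> B * indicator {z \<in> cone s. ereal 1 \<le> fst z} z" for n
    using cutoff_bound[of n] cutoff_eq_0[of _ n]
    by (intro AE_I2) (auto simp: space_nu indicator_def one_ereal_def not_le)
  show "AE z in \<nu>. (\<lambda>n. cutoff f n z) \<longlonglongrightarrow> indicator {1<..} (fst z) * f (real_part z)"
    using AE_nu_finite
  proof eventually_elim
    case (elim z)
    have "eventually (\<lambda>n. \<bar>snd z i\<bar> \<le> ereal (real (Suc n))) sequentially" if i: "i \<in> {0..s}" for i
    proof -
      obtain t where t: "snd z i = ereal t"
        using bspec[OF elim i] by (cases "snd z i") auto
      obtain m where "\<bar>t\<bar> \<le> real m"
        using real_arch_simple by blast
      then show ?thesis
        by (intro eventually_sequentiallyI[of m]) (simp add: t)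
    qed
    then have "eventually (\<lambda>n. \<forall>i\<in>{0..s}. \<bar>snd z i\<bar> \<le> ereal (real (Suc n))) sequentially"
      by (intro eventually_ball_finite) auto
    then have "eventually (\<lambda>n. f (clamp_part (real (Suc n)) z) = f (real_part z)) sequentially"
      by eventually_elim (auto intro!: arg_cong[where f = f] clamp_part_eq_real_part)
    then have "(\<lambda>n. f (clamp_part (real (Suc n)) z)) \<longlonglongrightarrow> f (real_part z)"
      by (rule tendsto_eventually)
    then show ?case
      unfolding cutoff_def by (intro tendsto_mult ramp_tendsto_indicator)
  qed
qed

text \<open>The ramp costs at most B, and only for z_0 between 1 and the end of the ramp. The clamp
  costs at most 2 B, and only if some coordinate exceeds n + 1; the sum of indicators is the union
  bound. In expectation, every term becomes a tail probability.\<close>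

lemma cutoff_error:
  "\<bar>indicator {1<..} (fst z) * f (real_part z) - cutoff f n z\<bar>
    \<le> B * (indicator {1<..} (fst z) - indicator {ereal (1 + inverse (real (Suc n)))<..} (fst z))
      + 2 * B * (\<Sum>i\<in>{0..s}. indicator {ereal (real (Suc n))<..} \<bar>snd z i\<bar>)"
proof (cases "1 < fst z")
  case False
  then have "\<not> ereal (1 + inverse (real (Suc n))) < fst z"
    using less_trans[of "ereal 1" "ereal (1 + inverse (real (Suc n)))" "fst z"]
    unfolding one_ereal_def less_ereal.simps(1) by (auto simp del: of_nat_Suc)
  with False B_nonneg show ?thesis
    by (simp add: cutoff_eq_0 sum_nonneg)
next
  case True
  let ?b = "1 + inverse (real (Suc n))"
  define h where "h = ramp 1 ?b (fst z)"
  define v where "v = f (clamp_part (real (Suc n)) z)"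
  define k :: real where "k = indicator {ereal ?b<..} (fst z)"
  define m :: real where "m = (\<Sum>i\<in>{0..s}. indicator {ereal (real (Suc n))<..} \<bar>snd z i\<bar>)"
  have m0: "0 \<le> m" unfolding m_def by (simp add: sum_nonneg)
  have h: "0 \<le> h" "h \<le> 1" using ramp_bounds[of 1 ?b] by (auto simp: h_def)
  have hk: "1 - h \<le> 1 - k"
    using h ramp_eq_1[of 1 ?b "fst z"] by (auto simp: h_def k_def indicator_def)
  have "\<bar>f (real_part z) - v\<bar> \<le> 2 * B * m"
  proof (cases "\<forall>i\<in>{0..s}. \<bar>snd z i\<bar> \<le> ereal (real (Suc n))")
    case True
    then have "clamp_part (real (Suc n)) z = real_part z"
      by (intro clamp_part_eq_real_part) auto
    then show ?thesis
      using m0 B_nonneg by (simp add: v_def)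
  next
    case False
    then obtain i where i: "i \<in> {0..s}" "ereal (real (Suc n)) < \<bar>snd z i\<bar>"
      by (auto simp: not_le)
    have "(1::real) = indicator {ereal (real (Suc n))<..} \<bar>snd z i\<bar>"
      using i by simp
    also have "\<dots> \<le> m"
      unfolding m_def by (rule member_le_sum[OF i(1)]) auto
    finally have "2 * B * 1 \<le> 2 * B * m"
      using B_nonneg by (intro mult_left_mono) auto
    then show ?thesis
      using f_real_part_bound[of z] f_clamp_part_bound[of "real (Suc n)" z] by (simp add: v_def)
  qed
  then have 1: "h * \<bar>f (real_part z) - v\<bar> \<le> 2 * B * m"
    using mult_right_mono[OF h(2), of "\<bar>f (real_part z) - v\<bar>"] by simp
  have 2: "(1 - h) * \<bar>f (real_part z)\<bar> \<le> (1 - k) * B"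
    using hk h f_real_part_bound[of z] by (intro mult_mono) auto
  \<comment> \<open>The splitting separates the ramp error, weighted by 1 - h, from the clamp error,
    weighted by h.\<close>
  have "f (real_part z) - h * v = (1 - h) * f (real_part z) + h * (f (real_part z) - v)"
    by (simp add: algebra_simps)
  then have "\<bar>f (real_part z) - h * v\<bar> \<le> (1 - h) * \<bar>f (real_part z)\<bar> + h * \<bar>f (real_part z) - v\<bar>"
    using h abs_triangle_ineq[of "(1 - h) * f (real_part z)" "h * (f (real_part z) - v)"]
    by (simp add: abs_mult)
  also have "\<dots> \<le> B * (1 - k) + 2 * B * m"
    using 1 2 by (simp add: mult.commute)
  finally show ?thesis
    using True by (simp add: cutoff_def h_def v_def k_def m_def)
qed

text \<open>The integrand is neither continuous nor defined by clamped values, so it is compared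
  with the cut-offs through \<open>tendsto_approx\<close>, uniformly enough because the error is
  bounded by tails.\<close>

lemma conditional_integral_tendsto:
  "((\<lambda>x. expectation (\<lambda>\<omega>. indicator {1<..} (fst (scaled x \<omega>)) * f (real_part (scaled x \<omega>))) / U x)
    \<longlongrightarrow> (\<integral>z. indicator {1<..} (fst z) * f (real_part z) \<partial>\<nu>)) at_top"
proof (rule tendsto_approx[OF vague_cutoff cutoff_integral_tendsto])
  define b where "b n = 1 + inverse (real (Suc n))" for n
  \<comment> \<open>The expectation of the bound in \<open>cutoff_error\<close>, divided by U(x);
    \<open>e n\<close> collects the limits of its tail terms as x grows.\<close>
  define E where "E n x = B * (\<P>(\<omega> in M. V \<omega> > x) / U x - \<P>(\<omega> in M. V \<omega> > b n * x) / U x)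
    + 2 * B * (\<Sum>i\<in>{0..s}. \<P>(\<omega> in M. \<bar>W i \<omega>\<bar> > real (Suc n) * x) / U x)" for n x
  define e where "e n = B * (tail_mass - b n powr (- \<alpha>) * tail_mass)
    + 2 * B * (\<Sum>i\<in>{0..s}. D * (real (Suc n) powr (- \<alpha>) * tail_mass))" for n
  show "(E n \<longlongrightarrow> e n) at_top" for n
    unfolding E_def e_def
    by (intro tendsto_intros V_tail_U V_tail_scaled W_tail_scaled) (auto simp: b_def add_pos_pos)
  have b: "b \<longlonglongrightarrow> 1"
    unfolding b_def using LIMSEQ_inverse_real_of_nat_add[of 1] by simp
  \<comment> \<open>The ramp part cancels because b n tends to 1; the clamp part dies because
    \<alpha> > 0.\<close>
  have "e \<longlonglongrightarrow> B * (tail_mass - 1 powr (- \<alpha>) * tail_mass) + 2 * B * (\<Sum>i\<in>{0..s}. D * (0 * tail_mass))"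
    unfolding e_def using alpha_pos
    by (intro tendsto_intros b tendsto_neg_powr
        filterlim_compose[OF filterlim_real_sequentially filterlim_Suc]) auto
  then show "e \<longlonglongrightarrow> 0" by simp
  show "\<forall>\<^sub>F x in at_top.
      \<bar>expectation (\<lambda>\<omega>. indicator {1<..} (fst (scaled x \<omega>)) * f (real_part (scaled x \<omega>))) / U x
        - expectation (\<lambda>\<omega>. cutoff f n (scaled x \<omega>)) / U x\<bar> \<le> E n x" for n
    using U_pos eventually_gt_at_top[of 0]
  proof eventually_elim
    case (elim x)
    let ?F = "\<lambda>\<omega>. indicator {1<..} (fst (scaled x \<omega>)) * f (real_part (scaled x \<omega>))"
    let ?G = "\<lambda>\<omega>. cutoff f n (scaled x \<omega>)"
    let ?H1 = "\<lambda>\<omega>. B * (indicator {\<omega> \<in> space M. V \<omega> > x} \<omega> - indicator {\<omega> \<in> space M. V \<omega> > b n * x} \<omega>)"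
    let ?H2 = "\<lambda>\<omega>. 2 * B * (\<Sum>i\<in>{0..s}. indicator {\<omega> \<in> space M. \<bar>W i \<omega>\<bar> > real (Suc n) * x} \<omega>)"
    let ?H = "\<lambda>\<omega>. ?H1 \<omega> + ?H2 \<omega>"
    have F: "integrable M ?F"
      using f_real_part_bound B_nonneg
      by (intro integrable_const_bound[where B = B]) (auto simp: indicator_def)
    have G: "integrable M ?G"
      using cutoff_bound by (intro integrable_const_bound[where B = B]) auto
    have ind: "integrable M (indicat_real {\<omega> \<in> space M. V \<omega> > a})"
      "i \<in> {0..s} \<Longrightarrow> integrable M (indicat_real {\<omega> \<in> space M. \<bar>W i \<omega>\<bar> > a})" for a i
      by (auto intro!: integrable_real_indicator simp: emeasure_eq_measure)
    have H1: "integrable M ?H1"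
      by (intro integrable_mult_right Bochner_Integration.integrable_diff ind)
    have H2: "integrable M ?H2"
      by (intro integrable_mult_right Bochner_Integration.integrable_sum ind)
    have EH1: "expectation ?H1 = B * (\<P>(\<omega> in M. V \<omega> > x) - \<P>(\<omega> in M. V \<omega> > b n * x))"
      by (simp add: Bochner_Integration.integral_diff[OF ind(1) ind(1)])
    have EH2: "expectation ?H2 = 2 * B * (\<Sum>i\<in>{0..s}. \<P>(\<omega> in M. \<bar>W i \<omega>\<bar> > real (Suc n) * x))"
      unfolding Bochner_Integration.integral_mult_right_zero
      by (subst Bochner_Integration.integral_sum) (auto simp: ind simp del: of_nat_Suc)
    have "\<bar>expectation ?F - expectation ?G\<bar> = \<bar>expectation (\<lambda>\<omega>. ?F \<omega> - ?G \<omega>)\<bar>"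
      using F G by simp
    also have "\<dots> \<le> expectation (\<lambda>\<omega>. \<bar>?F \<omega> - ?G \<omega>\<bar>)"
      by (rule integral_abs_bound)
    also have "\<dots> \<le> expectation ?H"
    proof (rule integral_mono[OF integrable_abs[OF Bochner_Integration.integrable_diff[OF F G]]
          Bochner_Integration.integrable_add[OF H1 H2]])
      show "\<bar>?F \<omega> - ?G \<omega>\<bar> \<le> ?H \<omega>" if "\<omega> \<in> space M" for \<omega>
      proof -
        have "indicator {1<..} (fst (scaled x \<omega>)) = indicat_real {\<omega> \<in> space M. V \<omega> > x} \<omega>"
          using that scaled_fst_iff[OF elim(2), of 1 \<omega>] by (simp add: indicator_def one_ereal_def)
        moreover have "indicator {ereal (b n)<..} (fst (scaled x \<omega>)) = indicat_real {\<omega> \<in> space M. V \<omega> > b n * x} \<omega>"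
          using that scaled_fst_iff[OF elim(2), of "b n" \<omega>] by (simp add: indicator_def)
        moreover have "(\<Sum>i\<in>{0..s}. indicator {ereal (real (Suc n))<..} \<bar>snd (scaled x \<omega>) i\<bar>)
            = (\<Sum>i\<in>{0..s}. indicat_real {\<omega> \<in> space M. \<bar>W i \<omega>\<bar> > real (Suc n) * x} \<omega>)"
          using that scaled_snd_iff[OF elim(2), of _ "real (Suc n)" \<omega>]
          by (intro sum.cong refl) (simp add: indicator_def)
        ultimately show ?thesis
          using cutoff_error[of "scaled x \<omega>" n] unfolding b_def[symmetric] by simp
      qed
    qed
    also have "expectation ?H = B * (\<P>(\<omega> in M. V \<omega> > x) - \<P>(\<omega> in M. V \<omega> > b n * x))
      + 2 * B * (\<Sum>i\<in>{0..s}. \<P>(\<omega> in M. \<bar>W i \<omega>\<bar> > real (Suc n) * x))"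
      unfolding Bochner_Integration.integral_add[OF H1 H2] EH1 EH2 ..
    finally have "\<bar>expectation ?F - expectation ?G\<bar> / U x \<le> \<dots> / U x"
      using elim by (intro divide_right_mono) auto
    also have "\<dots> = E n x"
      unfolding E_def
      by (simp add: add_divide_distrib diff_divide_distrib[symmetric] sum_divide_distrib[symmetric] del: of_nat_Suc)
    finally show ?case
      using elim by (simp add: diff_divide_distrib[symmetric])
  qed
qed

end


subsection \<open>The conditional limit law\<close>

text \<open>The density normalises \<open>\<nu>\<close> on {z_0 > 1}. The value 0 that
  \<open>real_part\<close> assigns to infinite coordinates is immaterial, since those points are
  null.\<close>

definition limit_law :: "(nat \<Rightarrow> real) measure" where
  "limit_law = distr (density \<nu> (\<lambda>z. ennreal (indicator {1<..} (fst z) / tail_mass))) (vec_borel s) real_part"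

lemma measurable_limit_density: "(\<lambda>z. indicat_real {1<..} (fst z) / tail_mass) \<in> borel_measurable \<nu>"
  by (rule measurable_nu) measurable

lemma prob_space_limit_law: "prob_space limit_law"
proof -
  have "emeasure (density \<nu> (\<lambda>z. ennreal (indicator {1<..} (fst z) / tail_mass))) (cone s)
      = (\<integral>\<^sup>+z. ennreal (indicator {1<..} (fst z) / tail_mass) * indicator (cone s) z \<partial>\<nu>)"
    using measurable_limit_density sets.top[of \<nu>] by (intro emeasure_density) (auto simp: space_nu)
  also have "\<dots> = (\<integral>\<^sup>+z. ennreal (1 / tail_mass) * indicator {z \<in> cone s. 1 < fst z} z \<partial>\<nu>)"
    by (intro nn_integral_cong) (auto simp: indicator_def space_nu)
  also have "\<dots> = ennreal (1 / tail_mass) * emeasure \<nu> {z \<in> cone s. 1 < fst z}"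
    by (rule nn_integral_cmult_indicator[OF sets_fst_gt])
  also have "\<dots> = ennreal (1 / tail_mass) * ennreal tail_mass"
    using emeasure_fst_gt by (simp add: tail_mass_def emeasure_eq_ennreal_measure)
  also have "\<dots> = 1"
    using tail_mass_pos by (simp flip: ennreal_mult')
  finally have "prob_space (density \<nu> (\<lambda>z. ennreal (indicator {1<..} (fst z) / tail_mass)))"
    by (intro prob_spaceI) (simp add: space_nu)
  then show ?thesis
    unfolding limit_law_def
    by (rule prob_space.prob_space_distr) (simp add: measurable_nu)
qed

text \<open>The limit vector is realised canonically, by the coordinate maps on
  \<open>limit_law\<close>. Restricting to \<open>{0..s}\<close> changes nothing, as
  \<open>real_part\<close> is already extensional.\<close>

lemma integral_limit_law:
  assumes [measurable]: "f \<in> borel_measurable (vec_borel s)"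
  shows "(\<integral>y. f y \<partial>law limit_law s (\<lambda>i y. y i)) = (\<integral>z. indicator {1<..} (fst z) * f (real_part z) \<partial>\<nu>) / tail_mass"
proof -
  have id: "(\<lambda>y. \<lambda>i\<in>{0..s}. y i) \<in> measurable (vec_borel s) (vec_borel s)"
    unfolding vec_borel_def by (intro measurable_restrict) measurable
  have "(\<integral>y. f y \<partial>law limit_law s (\<lambda>i y. y i)) = (\<integral>y. f (\<lambda>i\<in>{0..s}. y i) \<partial>limit_law)"
    unfolding law_def by (rule integral_distr) (use id in \<open>simp_all add: limit_law_def\<close>)
  also have "\<dots> = (\<integral>z. f (\<lambda>i\<in>{0..s}. real_part z i) \<partial>density \<nu> (\<lambda>z. ennreal (indicator {1<..} (fst z) / tail_mass)))"
    unfolding limit_law_def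
    by (rule integral_distr) (use measurable_compose[OF id assms] in \<open>simp_all add: measurable_nu\<close>)
  also have "\<dots> = (\<integral>z. f (real_part z) \<partial>density \<nu> (\<lambda>z. ennreal (indicator {1<..} (fst z) / tail_mass)))"
    by (simp add: real_part_def cong: restrict_cong)
  also have "\<dots> = (\<integral>z. (indicator {1<..} (fst z) / tail_mass) *\<^sub>R f (real_part z) \<partial>\<nu>)"
    by (rule integral_density[OF measurable_nu measurable_limit_density])
       (use tail_mass_pos in \<open>auto simp: indicator_def\<close>)
  finally show ?thesis by simp
qed

lemma integral_cond_law:
  assumes [measurable]: "f \<in> borel_measurable (vec_borel s)"
    and x: "x > 0" and pos: "\<P>(\<omega> in M. V \<omega> > x) > 0"
  shows "(\<integral>y. f y \<partial>cond_law M s (\<lambda>i \<omega>. W i \<omega> / x) (\<lambda>\<omega>. V \<omega> > x))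
    = expectation (\<lambda>\<omega>. indicator {1<..} (fst (scaled x \<omega>)) * f (real_part (scaled x \<omega>))) / \<P>(\<omega> in M. V \<omega> > x)"
proof -
  let ?A = "{\<omega> \<in> space M. V \<omega> > x}"
  \<comment> \<open>A positive probability lets the \<open>ennreal\<close> quotient be written as a
    real density, as \<open>integral_density\<close> demands.\<close>
  have A: "uniform_measure M ?A = density M (\<lambda>\<omega>. ennreal (indicator ?A \<omega> / prob ?A))"
    unfolding uniform_measure_def using pos
    by (intro density_cong) (auto simp: emeasure_eq_measure indicator_def divide_ennreal[symmetric])
  have W: "(\<lambda>\<omega>. \<lambda>i\<in>{0..s}. W i \<omega> / x) \<in> measurable M (vec_borel s)"
    unfolding vec_borel_def by (intro measurable_restrict) measurable
  have "(\<integral>y. f y \<partial>cond_law M s (\<lambda>i \<omega>. W i \<omega> / x) (\<lambda>\<omega>. V \<omega> > x))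
      = (\<integral>\<omega>. f (\<lambda>i\<in>{0..s}. W i \<omega> / x) \<partial>uniform_measure M ?A)"
    unfolding cond_law_def law_def by (rule integral_distr) (use W in simp_all)
  also have "\<dots> = expectation (\<lambda>\<omega>. (indicator ?A \<omega> / prob ?A) *\<^sub>R f (\<lambda>i\<in>{0..s}. W i \<omega> / x))"
    unfolding A by (rule integral_density) (use measurable_compose[OF W assms(1)] in auto)
  also have "\<dots> = expectation (\<lambda>\<omega>. indicator {1<..} (fst (scaled x \<omega>)) * f (real_part (scaled x \<omega>)) / prob ?A)"
    using scaled_fst_iff[OF x, of 1]
    by (intro Bochner_Integration.integral_cong refl)
       (auto simp: real_part_scaled indicator_def one_ereal_def)
  finally show ?thesis by simp
qed

theorem conditional_law_converges:
  "weak_convergence (vec_topology s)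
     (\<lambda>x. cond_law M s (\<lambda>i \<omega>. W i \<omega> / x) (\<lambda>\<omega>. V \<omega> > x)) (law limit_law s (\<lambda>i y. y i)) at_top"
  unfolding weak_convergence_def
proof (intro allI impI, elim conjE)
  fix f :: "(nat \<Rightarrow> real) \<Rightarrow> real"
  assume f: "continuous_map (vec_topology s) euclideanreal f" "bounded (f ` topspace (vec_topology s))"
  obtain B where B: "\<And>y. y \<in> topspace (vec_topology s) \<Longrightarrow> \<bar>f y\<bar> \<le> B"
    using f(2) unfolding bounded_iff by auto
  note f_meas = measurable_continuous_map_vec[OF f(1)]
  \<comment> \<open>Numerator and denominator converge separately after division by U(x), which then
    cancels; c > 0 permits the quotient of the limits.\<close>
  have "((\<lambda>x. (expectation (\<lambda>\<omega>. indicator {1<..} (fst (scaled x \<omega>)) * f (real_part (scaled x \<omega>))) / U x) /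
      (\<P>(\<omega> in M. V \<omega> > x) / U x)) \<longlongrightarrow> (\<integral>z. indicator {1<..} (fst z) * f (real_part z) \<partial>\<nu>) / tail_mass) at_top"
    using tail_mass_pos by (intro tendsto_divide conditional_integral_tendsto[OF f(1) B] V_tail_U) auto
  then show "((\<lambda>x. \<integral>y. f y \<partial>cond_law M s (\<lambda>i \<omega>. W i \<omega> / x) (\<lambda>\<omega>. V \<omega> > x)) \<longlongrightarrow>
      (\<integral>y. f y \<partial>law limit_law s (\<lambda>i y. y i))) at_top"
    unfolding integral_limit_law[OF f_meas]
  proof (rule Lim_transform_eventually)
    show "\<forall>\<^sub>F x in at_top. (expectation (\<lambda>\<omega>. indicator {1<..} (fst (scaled x \<omega>)) * f (real_part (scaled x \<omega>))) / U x) /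
      (\<P>(\<omega> in M. V \<omega> > x) / U x) = (\<integral>y. f y \<partial>cond_law M s (\<lambda>i \<omega>. W i \<omega> / x) (\<lambda>\<omega>. V \<omega> > x))"
      using U_pos V_tail_pos eventually_gt_at_top[of 0]
      by eventually_elim (simp add: integral_cond_law[OF f_meas])
  qed
qed

end


section \<open>Stationary time series\<close>

lemma stationary_prob_eq:
  assumes st: "stationary M Y" and A [measurable]: "A \<in> sets borel"
  shows "\<P>(\<omega> in M. Y h \<omega> \<in> A) = \<P>(\<omega> in M. Y 0 \<omega> \<in> A)"
proof -
  let ?P = "\<Pi>\<^sub>M t\<in>UNIV. (borel :: real measure)"
  \<comment> \<open>The cylinder over time 0: the path shifted by k lies in it exactly when Y at
    time k lies in A.\<close>
  let ?B = "{y \<in> space ?P. y (0::int) \<in> A}"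
  have Y: "\<And>t. Y t \<in> borel_measurable M"
    using st by (simp add: stationary_def)
  have B: "?B \<in> sets ?P" by measurable
  have "measure (distr M ?P (\<lambda>\<omega> t. Y (t + k) \<omega>)) ?B = \<P>(\<omega> in M. Y k \<omega> \<in> A)" for k
  proof -
    have "(\<lambda>\<omega> t. Y (t + k) \<omega>) \<in> measurable M ?P"
      by (rule measurable_PiM_single') (use Y in auto)
    from measure_distr[OF this B] show ?thesis
      by (auto intro!: arg_cong[where f = "measure M"] simp: space_PiM)
  qed
  from this[of h] this[of 0] show ?thesis
    using st unfolding stationary_def by simp
qed

theorem proposition5p1:
  fixes s :: nat and M :: "'a measure" and S :: "'b measure"
    and eps :: "int \<Rightarrow> 'a \<Rightarrow> 'b"
    and X Y :: "int \<Rightarrow> 'a \<Rightarrow> real"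
    and \<Phi> :: "real \<times> 'b \<Rightarrow> real" and \<Psi> :: "real \<times> (nat \<Rightarrow> 'b) \<Rightarrow> real"
    and \<alpha> :: real
  assumes "s \<ge> 1"
    and "prob_space M"
    and "iid M S eps"
    and "\<Phi> \<in> borel_measurable (borel \<Otimes>\<^sub>M S)"
    and "\<Psi> \<in> borel_measurable (borel \<Otimes>\<^sub>M (\<Pi>\<^sub>M i\<in>{1..s}. S))"
    and "stationary M Y" and "stationary M X"
    and "\<And>t. AE \<omega> in M. Y t \<omega> = \<Phi> (Y (t - 1) \<omega>, eps t \<omega>)"
    and "\<And>t. AE \<omega> in M. X t \<omega> = \<Psi> (Y t \<omega>, \<lambda>i\<in>{1..s}. eps (t + int i) \<omega>)"
    and "\<And>r. indep_elements M
           (\<Pi>\<^sub>M t\<in>{r<..}. S) (\<lambda>\<omega>. \<lambda>t\<in>{r<..}. eps t \<omega>)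
           (\<Pi>\<^sub>M t\<in>{..r}. borel) (\<lambda>\<omega>. \<lambda>t\<in>{..r}. Y t \<omega>)"
    and "multivariate_regularly_varying M s (\<lambda>\<omega>. \<bar>X 0 \<omega>\<bar>) (\<lambda>i. Y (int i)) \<alpha>"
    and "condition_1 M (X 0) (Y 0) \<alpha>"
  shows "\<exists>(N :: (nat \<Rightarrow> real) measure) (YX :: nat \<Rightarrow> (nat \<Rightarrow> real) \<Rightarrow> real).
           prob_space N \<and> (\<forall>i\<in>{0..s}. YX i \<in> borel_measurable N) \<and>
           weak_convergence (vec_topology s)
             (\<lambda>x. cond_law M s (\<lambda>i \<omega>. Y (int i) \<omega> / x) (\<lambda>\<omega>. \<bar>X 0 \<omega>\<bar> > x))
             (law N s YX) at_top"
proof -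
  interpret prob_space M by fact
  obtain U \<nu> where U: "regularly_varying U (- \<alpha>)" and \<nu>: "nondegenerate_radon s \<nu>"
    and vague: "vague_convergence (cone_topology s)
      (\<lambda>x. scale_measure (ennreal (1 / U x)) (scaled_law M s (\<lambda>\<omega>. \<bar>X 0 \<omega>\<bar>) (\<lambda>i. Y (int i)) x)) \<nu> at_top"
    using assms unfolding multivariate_regularly_varying_def by blast
  obtain p' C where \<alpha>: "\<alpha> > 0" and C: "C > 0" and bal: "balanced_tails M (X 0) \<alpha> p'"
    and CX: "((\<lambda>x. \<P>(\<omega> in M. \<bar>X 0 \<omega>\<bar> > x) / \<P>(\<omega> in M. \<bar>Y 0 \<omega>\<bar> > x)) \<longlongrightarrow> C) at_top"
    using assms unfolding condition_1_def by blast
  have meas: "X 0 \<in> borel_measurable M" "\<And>t. Y t \<in> borel_measurable M"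
    using assms by (auto simp: stationary_def)
  have Y_tail: "\<P>(\<omega> in M. \<bar>Y (int i) \<omega>\<bar> > x) = \<P>(\<omega> in M. \<bar>Y 0 \<omega>\<bar> > x)" for i x
    using stationary_prob_eq[OF \<open>stationary M Y\<close>, of "{y. \<bar>y\<bar> > x}" "int i"] by simp
  \<comment> \<open>Condition 1 compares |X_0| with |Y_0|; inverting the ratio, which needs C
    nonzero, and using stationarity gives the same D = 1/C for all i.\<close>
  have tail: "((\<lambda>x. \<P>(\<omega> in M. \<bar>Y (int i) \<omega>\<bar> > x) / \<P>(\<omega> in M. \<bar>X 0 \<omega>\<bar> > x)) \<longlongrightarrow> inverse C) at_top" for i
    using tendsto_inverse[OF CX] C unfolding Y_tail by (simp add: field_simps)
  interpret regularly_varying_vector M s "\<lambda>\<omega>. \<bar>X 0 \<omega>\<bar>" "\<lambda>i. Y (int i)" \<alpha> "inverse C" U \<nu>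
    by unfold_locales (use meas \<alpha> U \<nu> vague bal tail in \<open>auto simp: balanced_tails_def\<close>)
  have "(\<lambda>y. y i) \<in> borel_measurable limit_law" if "i \<in> {0..s}" for i
    using that by (simp add: limit_law_def vec_borel_def)
  \<comment> \<open>The witnesses are the probability space \<open>limit_law\<close> and its
    coordinate maps.\<close>
  then show ?thesis
    using prob_space_limit_law conditional_law_converges
    by (intro exI[of _ limit_law] exI[of _ "\<lambda>i y. y i"]) auto
qed

end
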